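(* Let $\phi\in L^2(\mathbb{R})\setminus\{0\}$ be such that $\widehat{\phi}(\gamma)$ is a complex linear combination of square integrable functions whose germs belong to $\overline{\mathcal{LE}(\mathbb{R})}$. Then every non-trivial finite wavelet system generated by $\phi$ is linearly independent.
   Context: $\widehat{\phi}$ is the Fourier transform of $\phi$ (the extension to $L^2(\mathbb{R})$ of $\widehat{\phi}(\gamma)=\int_{\mathbb{R}}\phi(x)e^{-2\pi i x\gamma}\,dx$). Consider real-valued functions that are ultimately defined, i.e. defined everywhere on an interval $(A,\infty)$ for some real number $A$. Two such functions $f,g$ are equivalent if $f(x)=g(x)$ for all sufficiently large $x$; the equivalence class of $f$ is its germ, $germ(f)$. $\mathcal{LE}(\mathbb{R})$ is the space of logarithmico-exponential functions: real-valued functions that can be expressed using the standard arithmetic operations $+,-,\times,\div$ along with the identity, constant, exponential and logarithmic functions. $\overline{\mathcal{LE}(\mathbb{R})}=\{germ(f): f\in\mathcal{LE}(\mathbb{R})\}$. For a finite set $\Lambda=\{(\lambda_k,\beta_k)\}_{k=1}^N\subset(0,\infty)\times\mathbb{R}$, the finite wavelet system generated by $\phi$ and parameterized by $\Lambda$ is $\mathcal{W}(\phi,\Lambda)=\{\phi(\lambda_kx-\beta_k)\}_{k=1}^N$; non-trivial means that the points $(\lambda_k,\beta_k)$ are distinct. It is linearly independent if $\sum_{k=1}^Nc_k\phi(\lambda_kx-\beta_k)=0$ for almost every $x$, with $c_k\in\mathbb{C}$, implies that all $c_k=0$.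
   Formalization: Adds the hypothesis that φ̂ is not a.e. zero on (0,∞); without it the claim fails: the projection φ of 1_[0,1) onto negative frequencies has zero germs at +∞, yet φ(x)=φ(2x)+φ(2x−1). *)

theory Defs
  imports "HOL-Analysis.Analysis"
begin

definition square_integrable :: "(real \<Rightarrow> 'a::real_normed_vector) \<Rightarrow> bool" where
  "square_integrable f \<longleftrightarrow>
     f \<in> borel_measurable lebesgue \<and> integrable lebesgue (\<lambda>x. (norm (f x))\<^sup>2)"

definition L2_tendsto :: "(nat \<Rightarrow> real \<Rightarrow> complex) \<Rightarrow> (real \<Rightarrow> complex) \<Rightarrow> bool" where
  "L2_tendsto F f \<longleftrightarrow>
     (\<forall>n. square_integrable (F n)) \<and> square_integrable f \<and>
     (\<lambda>n. LINT x|lebesgue. (norm (F n x - f x))\<^sup>2) \<longlonglongrightarrow> 0"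

text \<open>The integral formula for the Fourier transform, meaningful for integrable \<open>f\<close>.\<close>

definition fourier :: "(real \<Rightarrow> complex) \<Rightarrow> real \<Rightarrow> complex" where
  "fourier f \<gamma> =
     (LINT x|lebesgue. f x * exp (- 2 * complex_of_real pi * \<i> * complex_of_real x * complex_of_real \<gamma>))"

text \<open>
  The Fourier transform on \<open>L\<^sup>2\<close> is the continuous extension of \<^const>\<open>fourier\<close> from the dense
  subspace of integrable square integrable functions: its graph is the \<open>L\<^sup>2\<close>-closure of the
  graph of \<^const>\<open>fourier\<close> on that subspace. Functions stand for their classes modulo null
  sets, so it is given as a relation; \<open>\<psi>\<close> is determined by \<open>\<phi>\<close> up to a null set.
\<close>

definition is_L2_fourier :: "(real \<Rightarrow> complex) \<Rightarrow> (real \<Rightarrow> complex) \<Rightarrow> bool" where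
  "is_L2_fourier \<phi> \<psi> \<longleftrightarrow>
     (\<exists>F. (\<forall>n. integrable lebesgue (F n)) \<and>
          L2_tendsto F \<phi> \<and> L2_tendsto (\<lambda>n. fourier (F n)) \<psi>)"

text \<open>
  An ultimately defined function is represented by a total function, whose values outside
  the interval \<open>(A, \<infinity>)\<close> are irrelevant because only germs at infinity are used.
\<close>

definition germ :: "(real \<Rightarrow> real) \<Rightarrow> (real \<Rightarrow> real) set" where
  "germ f = {g. \<forall>\<^sub>F x in at_top. g x = f x}"

text \<open>
  The side conditions of \<open>divide\<close> and \<open>ln\<close> express that the expression is ultimately defined;
  they exclude the conventional values of division by zero and of the logarithm at
  nonpositive arguments.
\<close>

inductive_set LE :: "(real \<Rightarrow> real) set" where
  ident: "(\<lambda>x. x) \<in> LE"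
| const: "(\<lambda>_. c) \<in> LE"
| add: "f \<in> LE \<Longrightarrow> g \<in> LE \<Longrightarrow> (\<lambda>x. f x + g x) \<in> LE"
| diff: "f \<in> LE \<Longrightarrow> g \<in> LE \<Longrightarrow> (\<lambda>x. f x - g x) \<in> LE"
| mult: "f \<in> LE \<Longrightarrow> g \<in> LE \<Longrightarrow> (\<lambda>x. f x * g x) \<in> LE"
| divide: "f \<in> LE \<Longrightarrow> g \<in> LE \<Longrightarrow> \<forall>\<^sub>F x in at_top. g x \<noteq> 0 \<Longrightarrow> (\<lambda>x. f x / g x) \<in> LE"
| exp: "f \<in> LE \<Longrightarrow> (\<lambda>x. exp (f x)) \<in> LE"
| ln: "f \<in> LE \<Longrightarrow> \<forall>\<^sub>F x in at_top. f x > 0 \<Longrightarrow> (\<lambda>x. ln (f x)) \<in> LE"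

text \<open>
  Pitfall: the zero germ belongs to \<open>LE_germs\<close>, and germs at \<open>+\<infinity>\<close> say nothing about the negative
  half line. A Fourier transform vanishing almost everywhere on \<open>(0, \<infinity>)\<close> therefore satisfies
  the germ condition vacuously, yet linear independence can fail for it: let \<open>\<phi>\<close> be the
  projection of the indicator of \<open>[0, 1)\<close> onto negative frequencies; the projection commutes
  with translations and positive dilations, so \<open>\<phi>(x) = \<phi>(2 x) + \<phi>(2 x - 1)\<close>. This is why the
  theorem explicitly assumes that the transform does not vanish almost everywhere on \<open>(0, \<infinity>)\<close>.
\<close>

definition LE_germs :: "(real \<Rightarrow> real) set set" where
  "LE_germs = germ ` LE"

text \<open>
  The system parameterized by the points \<open>p 1, \<dots>, p N\<close>, as a family indexed by \<open>k\<close>, where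
  \<open>p k\<close> is the pair \<open>(\<lambda>\<^sub>k, \<beta>\<^sub>k)\<close>.
\<close>

definition wavelet_system ::
  "(real \<Rightarrow> complex) \<Rightarrow> (nat \<Rightarrow> real \<times> real) \<Rightarrow> nat \<Rightarrow> real \<Rightarrow> complex" where
  "wavelet_system \<phi> p k = (\<lambda>x. \<phi> (fst (p k) * x - snd (p k)))"

definition ae_linearly_independent :: "nat \<Rightarrow> (nat \<Rightarrow> real \<Rightarrow> complex) \<Rightarrow> bool" where
  "ae_linearly_independent N w \<longleftrightarrow>
     (\<forall>c :: nat \<Rightarrow> complex.
        (AE x in lebesgue. (\<Sum>k=1..N. c k * w k x) = 0) \<longrightarrow> (\<forall>k\<in>{1..N}. c k = 0))"

end

theory Submission
  imports Defs "HOL-Probability.Levy" "HOL-Probability.Sinc_Integral"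
    "HOL-Complex_Analysis.Conformal_Mappings"
begin

text \<open>
  On the Fourier side a linear dependence reads \<open>\<Sum>b. e\<^sub>b * Q\<^sub>b \<psi> = 0\<close>, where \<open>\<psi>\<close> is the transform
  of \<open>\<phi>\<close>, the \<open>e\<^sub>b\<close> are distinct imaginary exponentials and the \<open>Q\<^sub>b\<close> are combinations of
  dilations with constant coefficients. Near infinity \<open>\<psi>\<close> and its dilates belong to the
  complexification of a Hardy field, over which imaginary exponentials are linearly independent
  because a Hardy field contains no oscillating functions; so every \<open>Q\<^sub>b \<psi>\<close> vanishes near infinity.
  Since the \<open>Q\<^sub>b\<close> commute, comparing the ends of the supports shows that every \<open>Q\<^sub>b \<psi>\<close> vanishes on
  the whole positive half line. But nontrivial combinations of dilations are injective on
  square integrable functions, and \<open>\<psi>\<close> is not zero there, so all \<open>Q\<^sub>b\<close> are zero.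
\<close>

section \<open>Hardy fields\<close>

text \<open>The obstacle is that germs control \<psi> only near infinity. If \<psi> vanishes beyond
  some point, the Hardy field argument gives nothing new, and on bounded intervals \<psi> is an
  arbitrary square integrable function, over which exponentials need not be independent. What
  remains there is the interplay of the largest dilations, which moves the support ends down step by
  step by a fixed factor until they reach 0. Square integrability is essential for the injectivity:
  the constant function 1 is killed by f(x) - f(x / 2). In the variable t = ln x a combination of
  dilations becomes a combination of translations, and the Fourier transform turns it into
  multiplication by a trigonometric polynomial, whose zeros form a null set. Since a square
  integrable function need not have a convergent Fourier integral, this is carried out with the
  transform integrated over intervals, which is an absolutely convergent integral against the
  functions \<open>window\<close>.\<close>

lemma eventually_at_top_deriv_cong:
  fixes f g :: "real \<Rightarrow> 'a::real_normed_vector"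
  assumes "\<forall>\<^sub>F x in at_top. (f has_vector_derivative f' x) (at x)"
    and "\<forall>\<^sub>F x in at_top. g x = f x"
  shows "\<forall>\<^sub>F x in at_top. (g has_vector_derivative f' x) (at x)"
proof -
  obtain A where A: "\<And>x. x \<ge> A \<Longrightarrow> (f has_vector_derivative f' x) (at x)"
    using assms(1) by (auto simp: eventually_at_top_linorder)
  obtain B where B: "\<And>x. x \<ge> B \<Longrightarrow> g x = f x"
    using assms(2) by (auto simp: eventually_at_top_linorder)
  have "(g has_vector_derivative f' x) (at x)" if "x > max A B" for x
  proof (rule has_vector_derivative_transform_within_open[of f])
    show "open {max A B<..}" "x \<in> {max A B<..}" using that by auto
    show "(f has_vector_derivative f' x) (at x)" using A that by simp
  qed (use B in auto)
  then show ?thesis unfolding eventually_at_top_dense by blast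
qed

lemma eventually_zero_or_nonzero_of_const:
  assumes "eventually (\<lambda>x. f x = c) F"
  shows "eventually (\<lambda>x. f x = 0) F \<or> eventually (\<lambda>x. f x \<noteq> 0) F"
proof (cases "c = 0")
  case False
  from assms have "eventually (\<lambda>x. f x \<noteq> 0) F" by eventually_elim (use False in simp)
  then show ?thesis ..
qed (use assms in simp)

text \<open>If the derivative vanishes on a half line, the function is constant there; if it has no
  zero there, Rolle's theorem leaves the function at most one. This carries the dichotomy from a
  derivative back to the function, which is what the induction in
  \<open>poly_upto_zero_or_nonzero\<close> needs.\<close>

lemma eventually_zero_or_nonzero_of_deriv:
  fixes g g' :: "real \<Rightarrow> real"
  assumes deriv: "\<forall>\<^sub>F x in at_top. (g has_real_derivative g' x) (at x)"
    and dich: "(\<forall>\<^sub>F x in at_top. g' x = 0) \<or> (\<forall>\<^sub>F x in at_top. g' x \<noteq> 0)"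
  shows "(\<forall>\<^sub>F x in at_top. g x = 0) \<or> (\<forall>\<^sub>F x in at_top. g x \<noteq> 0)"
  using dich
proof
  assume "\<forall>\<^sub>F x in at_top. g' x = 0"
  with deriv have "\<forall>\<^sub>F x in at_top. (g has_real_derivative 0) (at x)"
    by eventually_elim auto
  then obtain A where A: "\<And>x. x \<ge> A \<Longrightarrow> (g has_real_derivative 0) (at x)"
    by (auto simp: eventually_at_top_linorder)
  have "g x = g A" if "x \<ge> A" for x
  proof (cases "x = A")
    case False
    then show ?thesis using that
      by (intro DERIV_isconst2[of A x g x])
         (auto intro!: continuous_at_imp_continuous_on DERIV_isCont A)
  qed auto
  then have "\<forall>\<^sub>F x in at_top. g x = g A"
    unfolding eventually_at_top_linorder by blast
  then show ?thesis by (rule eventually_zero_or_nonzero_of_const)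
next
  assume "\<forall>\<^sub>F x in at_top. g' x \<noteq> 0"
  with deriv have "\<forall>\<^sub>F x in at_top. (g has_real_derivative g' x) (at x) \<and> g' x \<noteq> 0"
    by eventually_elim auto
  then obtain A where A: "\<And>x. x \<ge> A \<Longrightarrow> (g has_real_derivative g' x) (at x) \<and> g' x \<noteq> 0"
    by (auto simp: eventually_at_top_linorder)
  have uniq: False if "A \<le> u" "u < v" "g u = 0" "g v = 0" for u v
  proof -
    have "\<exists>z>u. z < v \<and> g v - g u = (v - u) * g' z"
      using that A by (intro MVT2) auto
    then obtain z where "z > u" "z < v" "g v - g u = (v - u) * g' z" by blast
    then show False using A[of z] that by auto
  qed
  have "\<forall>\<^sub>F x in at_top. g x \<noteq> 0"
  proof (cases "\<exists>u\<ge>A. g u = 0")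
    case True
    then obtain u where "u \<ge> A" "g u = 0" by auto
    then have "\<And>x. x > u \<Longrightarrow> g x \<noteq> 0" using uniq by blast
    then show ?thesis unfolding eventually_at_top_dense by blast
  next
    case False
    then show ?thesis unfolding eventually_at_top_linorder by blast
  qed
  then show ?thesis ..
qed

text \<open>The elements are functions, not germs; \<open>germ_closed\<close> makes the set a union
  of germs. Derivatives exist only eventually. The assumption \<open>inverse\<close> can be
  unconditional: an eventually zero function has an eventually zero inverse by convention, and
  otherwise \<open>zero_or_nonzero\<close> makes it a genuine inverse.\<close>

locale hardy_field =
  fixes K :: "(real \<Rightarrow> real) set"
  assumes const: "(\<lambda>_. c) \<in> K"
    and add: "f \<in> K \<Longrightarrow> g \<in> K \<Longrightarrow> (\<lambda>x. f x + g x) \<in> K"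
    and mult: "f \<in> K \<Longrightarrow> g \<in> K \<Longrightarrow> (\<lambda>x. f x * g x) \<in> K"
    and inverse: "f \<in> K \<Longrightarrow> (\<lambda>x. inverse (f x)) \<in> K"
    and germ_closed: "f \<in> K \<Longrightarrow> \<forall>\<^sub>F x in at_top. g x = f x \<Longrightarrow> g \<in> K"
    and zero_or_nonzero: "f \<in> K \<Longrightarrow> (\<forall>\<^sub>F x in at_top. f x = 0) \<or> (\<forall>\<^sub>F x in at_top. f x \<noteq> 0)"
    and deriv: "f \<in> K \<Longrightarrow> \<exists>f'\<in>K. \<forall>\<^sub>F x in at_top. (f has_real_derivative f' x) (at x)"
begin

lemma diff: "f \<in> K \<Longrightarrow> g \<in> K \<Longrightarrow> (\<lambda>x. f x - g x) \<in> K"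
  using add[of f "\<lambda>x. -1 * g x"] mult[OF const[of "-1"], of g] by simp

lemma divide: "f \<in> K \<Longrightarrow> g \<in> K \<Longrightarrow> (\<lambda>x. f x / g x) \<in> K"
  using mult[OF _ inverse] by (simp add: divide_inverse)

lemma uminus: "f \<in> K \<Longrightarrow> (\<lambda>x. - f x) \<in> K"
  using diff[OF const[of 0]] by simp

text \<open>Functions rather than formal polynomials, as \<open>y\<close> may be algebraic over
  \<open>K\<close>. The top coefficient may be zero, so \<open>n\<close> only bounds the degree; the
  recursion exposes this coefficient, on which the inductions work.\<close>

primrec poly_upto :: "(real \<Rightarrow> real) \<Rightarrow> nat \<Rightarrow> (real \<Rightarrow> real) set" where
  "poly_upto y 0 = K"
| "poly_upto y (Suc n) = {\<lambda>x. h x + a x * y x ^ Suc n | h a. h \<in> poly_upto y n \<and> a \<in> K}"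

lemma poly_upto_SucI:
  "h \<in> poly_upto y n \<Longrightarrow> a \<in> K \<Longrightarrow> (\<And>x. f x = h x + a x * y x ^ Suc n) \<Longrightarrow> f \<in> poly_upto y (Suc n)"
  unfolding poly_upto.simps by (intro CollectI exI[of _ h] exI[of _ a] conjI ext)

lemma poly_upto_Suc: "f \<in> poly_upto y n \<Longrightarrow> f \<in> poly_upto y (Suc n)"
  using poly_upto_SucI[of f y n "\<lambda>_. 0"] const by simp

lemma poly_upto_mono: "m \<le> n \<Longrightarrow> f \<in> poly_upto y m \<Longrightarrow> f \<in> poly_upto y n"
proof (induction n)
  case (Suc n)
  then show ?case using poly_upto_Suc[of f y n] by (cases "m = Suc n") auto
qed auto

lemma poly_upto_base: "f \<in> K \<Longrightarrow> f \<in> poly_upto y n"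
  using poly_upto_mono[of 0 n f y] by simp

lemma poly_upto_add: "f \<in> poly_upto y n \<Longrightarrow> g \<in> poly_upto y n \<Longrightarrow> (\<lambda>x. f x + g x) \<in> poly_upto y n"
proof (induction n arbitrary: f g)
  case (Suc n)
  then obtain h a k b where
    f: "f = (\<lambda>x. h x + a x * y x ^ Suc n)" "h \<in> poly_upto y n" "a \<in> K" and
    g: "g = (\<lambda>x. k x + b x * y x ^ Suc n)" "k \<in> poly_upto y n" "b \<in> K"
    by auto
  show ?case
    by (rule poly_upto_SucI[of "\<lambda>x. h x + k x" _ _ "\<lambda>x. a x + b x"])
       (use f g Suc.IH add in \<open>auto simp: algebra_simps\<close>)
qed (simp add: add)

lemma poly_upto_scale: "c \<in> K \<Longrightarrow> f \<in> poly_upto y n \<Longrightarrow> (\<lambda>x. c x * f x) \<in> poly_upto y n"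
proof (induction n arbitrary: f)
  case (Suc n)
  then obtain h a where f: "f = (\<lambda>x. h x + a x * y x ^ Suc n)" "h \<in> poly_upto y n" "a \<in> K"
    by auto
  show ?case
    by (rule poly_upto_SucI[OF Suc.IH[OF Suc.prems(1) f(2)] mult[OF Suc.prems(1) f(3)]])
       (simp add: f(1) algebra_simps)
qed (simp add: mult)

lemma poly_upto_monomial: "a \<in> K \<Longrightarrow> (\<lambda>x. a x * y x ^ n) \<in> poly_upto y n"
proof (cases n)
  case (Suc m)
  assume "a \<in> K"
  then show ?thesis unfolding Suc
    by (intro poly_upto_SucI[of "\<lambda>_. 0" _ _ a]) (auto intro: poly_upto_base const)
qed simp

lemma poly_upto_times_gen: "f \<in> poly_upto y n \<Longrightarrow> (\<lambda>x. f x * y x) \<in> poly_upto y (Suc n)"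
proof (induction n arbitrary: f)
  case 0
  then show ?case using poly_upto_monomial[of f y 1] by simp
next
  case (Suc n)
  then obtain h a where f: "f = (\<lambda>x. h x + a x * y x ^ Suc n)" "h \<in> poly_upto y n" "a \<in> K"
    by auto
  show ?case
    by (rule poly_upto_SucI[OF Suc.IH[OF f(2)] f(3)]) (simp add: f(1) algebra_simps)
qed

lemma poly_upto_times_power: "f \<in> poly_upto y n \<Longrightarrow> (\<lambda>x. f x * y x ^ m) \<in> poly_upto y (n + m)"
proof (induction m)
  case (Suc m)
  then show ?case using poly_upto_times_gen[of "\<lambda>x. f x * y x ^ m" y "n + m"]
    by (simp add: algebra_simps del: poly_upto.simps)
qed simp

lemma poly_upto_mult: "f \<in> poly_upto y m \<Longrightarrow> g \<in> poly_upto y n \<Longrightarrow> (\<lambda>x. f x * g x) \<in> poly_upto y (n + m)"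
proof (induction m arbitrary: f)
  case 0
  then show ?case using poly_upto_scale by simp
next
  case (Suc m)
  then obtain h a where f: "f = (\<lambda>x. h x + a x * y x ^ Suc m)" "h \<in> poly_upto y m" "a \<in> K"
    by auto
  have 1: "(\<lambda>x. h x * g x) \<in> poly_upto y (n + Suc m)"
    using poly_upto_Suc[OF Suc.IH[OF f(2) Suc.prems(2)]] by (simp del: poly_upto.simps)
  have 2: "(\<lambda>x. a x * (g x * y x ^ Suc m)) \<in> poly_upto y (n + Suc m)"
    using poly_upto_scale[OF f(3) poly_upto_times_power[OF Suc.prems(2), of "Suc m"]] .
  show ?case
    using poly_upto_add[OF 1 2] unfolding f(1) by (simp add: algebra_simps del: poly_upto.simps)
qed

text \<open>Equality with the quotient is required only eventually, which makes the set closed under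
  change of representative. The common degree bound is harmless by
  \<open>poly_upto_mono\<close>.\<close>

definition adjoin :: "(real \<Rightarrow> real) \<Rightarrow> (real \<Rightarrow> real) set" where
  "adjoin y = {h. \<exists>p q n. p \<in> poly_upto y n \<and> q \<in> poly_upto y n \<and> (\<forall>\<^sub>F x in at_top. q x \<noteq> 0) \<and>
     (\<forall>\<^sub>F x in at_top. h x = p x / q x)}"

lemma adjoinI:
  "p \<in> poly_upto y n \<Longrightarrow> q \<in> poly_upto y m \<Longrightarrow> \<forall>\<^sub>F x in at_top. q x \<noteq> 0 \<Longrightarrow>
   \<forall>\<^sub>F x in at_top. h x = p x / q x \<Longrightarrow> h \<in> adjoin y"
  unfolding adjoin_def
  using poly_upto_mono[of n "max n m" p y] poly_upto_mono[of m "max n m" q y] by auto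

lemma adjoinE:
  assumes "h \<in> adjoin y"
  obtains p q n where "p \<in> poly_upto y n" "q \<in> poly_upto y n" "\<forall>\<^sub>F x in at_top. q x \<noteq> 0"
    "\<forall>\<^sub>F x in at_top. h x = p x / q x"
  using assms unfolding adjoin_def by blast

lemma subset_adjoin: "K \<subseteq> adjoin y"
proof
  fix f assume "f \<in> K"
  then show "f \<in> adjoin y"
    by (intro adjoinI[of f y 0 "\<lambda>_. 1" 0]) (auto intro: const)
qed

lemma generator_in_adjoin: "y \<in> adjoin y"
  using poly_upto_monomial[OF const[of 1], of y 1]
  by (intro adjoinI[of y y 1 "\<lambda>_. 1" 0]) (auto intro: const simp del: poly_upto.simps(2))

end

text \<open>
  The hypothesis on \<open>y\<close> covers logarithms and the identity (\<open>\<alpha> = 0\<close>, \<open>E = 1\<close>) as well as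
  exponentials (\<open>\<beta> = 0\<close>, \<open>E = y\<close>); \<open>E\<close> is an integrating factor.
\<close>

locale hardy_field_extension = hardy_field +
  fixes y E \<alpha> \<beta> :: "real \<Rightarrow> real"
  assumes coeffs: "\<alpha> \<in> K" "\<beta> \<in> K"
    and y_deriv: "\<forall>\<^sub>F x in at_top. (y has_real_derivative \<alpha> x * y x + \<beta> x) (at x)"
    and E_pos: "\<forall>\<^sub>F x in at_top. E x > 0"
    and E_deriv: "\<forall>\<^sub>F x in at_top. (E has_real_derivative \<alpha> x * E x) (at x)"
begin

text \<open>The degree bound survives because the derivative of \<open>y\<close> is of degree at
  most one in \<open>y\<close>: differentiating \<open>y ^ Suc n\<close> produces only the powers
  \<open>n\<close> and \<open>Suc n\<close>.\<close>

lemma poly_upto_deriv: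
  "f \<in> poly_upto y n \<Longrightarrow> \<exists>f'\<in>poly_upto y n. \<forall>\<^sub>F x in at_top. (f has_real_derivative f' x) (at x)"
proof (induction n arbitrary: f)
  case 0
  then show ?case using deriv by simp
next
  case (Suc n)
  then obtain h a where f: "f = (\<lambda>x. h x + a x * y x ^ Suc n)" "h \<in> poly_upto y n" "a \<in> K"
    by auto
  from Suc.IH[OF f(2)] obtain h' where h': "h' \<in> poly_upto y n"
    "\<forall>\<^sub>F x in at_top. (h has_real_derivative h' x) (at x)" by auto
  from deriv[OF f(3)] obtain a' where a': "a' \<in> K"
    "\<forall>\<^sub>F x in at_top. (a has_real_derivative a' x) (at x)" by auto
  define f' where "f' = (\<lambda>x. (h' x + (of_nat (Suc n) * a x * \<beta> x) * y x ^ n)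
     + (a' x + of_nat (Suc n) * a x * \<alpha> x) * y x ^ Suc n)"
  have "f' \<in> poly_upto y (Suc n)"
  proof (rule poly_upto_SucI)
    show "(\<lambda>x. h' x + (of_nat (Suc n) * a x * \<beta> x) * y x ^ n) \<in> poly_upto y n"
      by (intro poly_upto_add h' poly_upto_monomial mult const f coeffs)
    show "(\<lambda>x. a' x + of_nat (Suc n) * a x * \<alpha> x) \<in> K"
      by (intro add a' mult const f coeffs)
  qed (simp add: f'_def)
  moreover have "\<forall>\<^sub>F x in at_top. (f has_real_derivative f' x) (at x)"
    using h'(2) a'(2) y_deriv
  proof eventually_elim
    case (elim x)
    show ?case unfolding f(1)
      by (rule derivative_eq_intros elim refl)+ (simp add: f'_def algebra_simps)
  qed
  ultimately show ?case by blast
qed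

text \<open>Induction on the degree. Once the polynomial is made monic, dividing by
  \<open>E ^ Suc n\<close> removes the homogeneous part of the equation for \<open>y\<close>, so the
  top terms of the derivative cancel: up to the factor \<open>E ^ Suc n\<close> the derivative has
  lower degree. Its dichotomy passes to the quotient by Rolle's theorem.\<close>

lemma poly_upto_zero_or_nonzero:
  "f \<in> poly_upto y n \<Longrightarrow> (\<forall>\<^sub>F x in at_top. f x = 0) \<or> (\<forall>\<^sub>F x in at_top. f x \<noteq> 0)"
proof (induction n arbitrary: f)
  case 0
  then show ?case using zero_or_nonzero by simp
next
  case (Suc n)
  then obtain h a where f: "f = (\<lambda>x. h x + a x * y x ^ Suc n)" "h \<in> poly_upto y n" "a \<in> K"
    by auto
  from zero_or_nonzero[OF f(3)] show ?case
  proof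
    assume "\<forall>\<^sub>F x in at_top. a x = 0"
    then have *: "\<forall>\<^sub>F x in at_top. f x = h x"
      unfolding f(1) by eventually_elim auto
    from Suc.IH[OF f(2)] show ?thesis
    proof
      assume "\<forall>\<^sub>F x in at_top. h x = 0"
      with * have "\<forall>\<^sub>F x in at_top. f x = 0" by eventually_elim auto
      then show ?thesis ..
    next
      assume "\<forall>\<^sub>F x in at_top. h x \<noteq> 0"
      with * have "\<forall>\<^sub>F x in at_top. f x \<noteq> 0" by eventually_elim auto
      then show ?thesis ..
    qed
  next
    assume a0: "\<forall>\<^sub>F x in at_top. a x \<noteq> 0"
    define k where "k = (\<lambda>x. inverse (a x) * h x)"
    have k: "k \<in> poly_upto y n" unfolding k_def by (intro poly_upto_scale inverse f)
    obtain k' where k': "k' \<in> poly_upto y n"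
      "\<forall>\<^sub>F x in at_top. (k has_real_derivative k' x) (at x)"
      using poly_upto_deriv[OF k] by auto
    \<comment> \<open>The term \<open>of_nat (Suc n) * \<alpha> x * y x ^ Suc n\<close> arises from
      the power of \<open>y\<close> and, with opposite sign, from the power of \<open>E\<close>;
      \<open>r\<close> consists of the terms that remain.\<close>
    define r where "r = (\<lambda>x. (k' x + (of_nat (Suc n) * \<beta> x) * y x ^ n)
      + (- of_nat (Suc n) * \<alpha> x) * k x)"
    have r: "r \<in> poly_upto y n" unfolding r_def
      by (intro poly_upto_add k' poly_upto_monomial poly_upto_scale mult const coeffs k)
    define g where "g = (\<lambda>x. (k x + y x ^ Suc n) / E x ^ Suc n)"
    have gd: "\<forall>\<^sub>F x in at_top. (g has_real_derivative r x / E x ^ Suc n) (at x)"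
      using k'(2) y_deriv E_deriv E_pos
    proof eventually_elim
      case (elim x)
      have "(g has_real_derivative
        ((k' x + of_nat (Suc n) * (\<alpha> x * y x + \<beta> x) * y x ^ n) * E x ^ Suc n
         - (k x + y x ^ Suc n) * (of_nat (Suc n) * (\<alpha> x * E x) * E x ^ n)) / (E x ^ Suc n * E x ^ Suc n)) (at x)"
        unfolding g_def using elim(4) by (auto intro!: derivative_eq_intros elim(1-3) simp del: power_Suc)
      also have "(k' x + of_nat (Suc n) * (\<alpha> x * y x + \<beta> x) * y x ^ n) * E x ^ Suc n
         - (k x + y x ^ Suc n) * (of_nat (Suc n) * (\<alpha> x * E x) * E x ^ n) = r x * E x ^ Suc n"
        unfolding r_def by (simp add: algebra_simps)
      also have "r x * E x ^ Suc n / (E x ^ Suc n * E x ^ Suc n) = r x / E x ^ Suc n"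
        using elim(4) by simp
      finally show ?case .
    qed
    have "(\<forall>\<^sub>F x in at_top. r x / E x ^ Suc n = 0) \<or> (\<forall>\<^sub>F x in at_top. r x / E x ^ Suc n \<noteq> 0)"
      using Suc.IH[OF r]
    proof
      assume "\<forall>\<^sub>F x in at_top. r x = 0"
      then have "\<forall>\<^sub>F x in at_top. r x / E x ^ Suc n = 0" by eventually_elim auto
      then show ?thesis ..
    next
      assume "\<forall>\<^sub>F x in at_top. r x \<noteq> 0"
      then have "\<forall>\<^sub>F x in at_top. r x / E x ^ Suc n \<noteq> 0"
        using E_pos by eventually_elim auto
      then show ?thesis ..
    qed
    from eventually_zero_or_nonzero_of_deriv[OF gd this] 
    have g0: "(\<forall>\<^sub>F x in at_top. g x = 0) \<or> (\<forall>\<^sub>F x in at_top. g x \<noteq> 0)" .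
    have fg: "\<forall>\<^sub>F x in at_top. f x = a x * E x ^ Suc n * g x \<and> a x * E x ^ Suc n \<noteq> 0"
      using a0 E_pos by eventually_elim (auto simp: f(1) g_def k_def field_simps)
    from g0 show ?thesis
    proof
      assume "\<forall>\<^sub>F x in at_top. g x = 0"
      with fg have "\<forall>\<^sub>F x in at_top. f x = 0" by eventually_elim auto
      then show ?thesis ..
    next
      assume "\<forall>\<^sub>F x in at_top. g x \<noteq> 0"
      with fg have "\<forall>\<^sub>F x in at_top. f x \<noteq> 0" by eventually_elim auto
      then show ?thesis ..
    qed
  qed
qed

lemma hardy_field_adjoin: "hardy_field (adjoin y)"
proof
  fix c show "(\<lambda>_. c) \<in> adjoin y" using subset_adjoin const by blast
next
  fix f g assume "f \<in> adjoin y" "g \<in> adjoin y"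
  then obtain p q n p2 q2 n2 where f: "p \<in> poly_upto y n" "q \<in> poly_upto y n"
    "\<forall>\<^sub>F x in at_top. q x \<noteq> 0" "\<forall>\<^sub>F x in at_top. f x = p x / q x"
    and g: "p2 \<in> poly_upto y n2" "q2 \<in> poly_upto y n2"
    "\<forall>\<^sub>F x in at_top. q2 x \<noteq> 0" "\<forall>\<^sub>F x in at_top. g x = p2 x / q2 x"
    by (elim adjoinE) blast
  have q0: "\<forall>\<^sub>F x in at_top. q x * q2 x \<noteq> 0"
    using f(3) g(3) by eventually_elim auto
  have "(\<lambda>x. q2 x * p x) \<in> poly_upto y (n + n2)"
    by (rule poly_upto_mult[OF g(2) f(1)])
  moreover have "(\<lambda>x. p2 x * q x) \<in> poly_upto y (n + n2)"
    by (rule poly_upto_mult[OF g(1) f(2)])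
  ultimately have s: "(\<lambda>x. q2 x * p x + p2 x * q x) \<in> poly_upto y (n + n2)"
    by (rule poly_upto_add)
  show "(\<lambda>x. f x + g x) \<in> adjoin y"
  proof (rule adjoinI[OF s poly_upto_mult[OF f(2) g(2)] q0])
    show "\<forall>\<^sub>F x in at_top. f x + g x = (q2 x * p x + p2 x * q x) / (q x * q2 x)"
      using f(3,4) g(3,4) by eventually_elim (simp add: field_simps)
  qed
  show "(\<lambda>x. f x * g x) \<in> adjoin y"
  proof (rule adjoinI[OF poly_upto_mult[OF f(1) g(1)] poly_upto_mult[OF f(2) g(2)] q0])
    show "\<forall>\<^sub>F x in at_top. f x * g x = (p x * p2 x) / (q x * q2 x)"
      using f(3,4) g(3,4) by eventually_elim simp
  qed
next
  fix f assume "f \<in> adjoin y"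
  then obtain p q n where f: "p \<in> poly_upto y n" "q \<in> poly_upto y n"
    "\<forall>\<^sub>F x in at_top. q x \<noteq> 0" "\<forall>\<^sub>F x in at_top. f x = p x / q x"
    by (elim adjoinE) blast
  have p0: "(\<forall>\<^sub>F x in at_top. p x = 0) \<or> (\<forall>\<^sub>F x in at_top. p x \<noteq> 0)"
    by (rule poly_upto_zero_or_nonzero[OF f(1)])
  show "(\<lambda>x. inverse (f x)) \<in> adjoin y"
    using p0
  proof
    assume "\<forall>\<^sub>F x in at_top. p x = 0"
    \<comment> \<open>Here \<open>f\<close> is eventually zero, and its inverse is eventually 0 by
      the convention for division by zero.\<close>
    with f(4) have "\<forall>\<^sub>F x in at_top. inverse (f x) = 0 / 1" by eventually_elim auto
    then show ?thesis
      by (intro adjoinI[of "\<lambda>_. 0" y 0 "\<lambda>_. 1" 0]) (auto intro: const)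
  next
    assume p1: "\<forall>\<^sub>F x in at_top. p x \<noteq> 0"
    have "\<forall>\<^sub>F x in at_top. inverse (f x) = q x / p x" using f(4) by eventually_elim auto
    then show ?thesis by (rule adjoinI[OF f(2,1) p1])
  qed
  show "(\<forall>\<^sub>F x in at_top. f x = 0) \<or> (\<forall>\<^sub>F x in at_top. f x \<noteq> 0)"
    using p0
  proof
    assume "\<forall>\<^sub>F x in at_top. p x = 0"
    with f(4) have "\<forall>\<^sub>F x in at_top. f x = 0" by eventually_elim auto
    then show ?thesis ..
  next
    assume "\<forall>\<^sub>F x in at_top. p x \<noteq> 0"
    with f(3,4) have "\<forall>\<^sub>F x in at_top. f x \<noteq> 0" by eventually_elim auto
    then show ?thesis ..
  qed
  obtain p' where p': "p' \<in> poly_upto y n"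
      "\<forall>\<^sub>F x in at_top. (p has_real_derivative p' x) (at x)"
    using poly_upto_deriv[OF f(1)] by auto
  obtain q' where q': "q' \<in> poly_upto y n"
      "\<forall>\<^sub>F x in at_top. (q has_real_derivative q' x) (at x)"
    using poly_upto_deriv[OF f(2)] by auto
  define h where "h = (\<lambda>x. (p' x * q x + (-1 * p x) * q' x) / (q x * q x))"
  have "h \<in> adjoin y"
  proof (rule adjoinI)
    show "(\<lambda>x. p' x * q x + (-1 * p x) * q' x) \<in> poly_upto y (n + n)"
      by (intro poly_upto_add poly_upto_mult p' q' f poly_upto_scale const)
    show "(\<lambda>x. q x * q x) \<in> poly_upto y (n + n)"
      by (intro poly_upto_mult f)
    show "\<forall>\<^sub>F x in at_top. q x * q x \<noteq> 0"
      using f(3) by eventually_elim auto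
  qed (simp add: h_def)
  moreover have "\<forall>\<^sub>F x in at_top. ((\<lambda>x. p x / q x) has_vector_derivative h x) (at x)"
    using p'(2) q'(2) f(3)
  proof eventually_elim
    case (elim x)
    then have "((\<lambda>x. p x / q x) has_real_derivative h x) (at x)"
      by (auto intro!: derivative_eq_intros simp: h_def)
    then show ?case by (simp add: has_real_derivative_iff_has_vector_derivative)
  qed
  then have "\<forall>\<^sub>F x in at_top. (f has_vector_derivative h x) (at x)"
    by (rule eventually_at_top_deriv_cong[OF _ f(4)])
  ultimately show "\<exists>f'\<in>adjoin y. \<forall>\<^sub>F x in at_top. (f has_real_derivative f' x) (at x)"
    by (auto simp: has_real_derivative_iff_has_vector_derivative)
next
  fix f g assume "f \<in> adjoin y" and eq: "\<forall>\<^sub>F x in at_top. g x = f x"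
  then obtain p q n where f: "p \<in> poly_upto y n" "q \<in> poly_upto y n"
    "\<forall>\<^sub>F x in at_top. q x \<noteq> 0" "\<forall>\<^sub>F x in at_top. f x = p x / q x"
    by (elim adjoinE) blast
  have "\<forall>\<^sub>F x in at_top. g x = p x / q x" using eq f(4) by eventually_elim auto
  then show "g \<in> adjoin y" by (rule adjoinI[OF f(1-3)])
qed

end

lemma (in hardy_field) hardy_field_extension_ex:
  assumes "\<alpha> \<in> K" "\<beta> \<in> K"
    and "\<forall>\<^sub>F x in at_top. (y has_real_derivative \<alpha> x * y x + \<beta> x) (at x)"
    and "\<forall>\<^sub>F x in at_top. E x > 0"
    and "\<forall>\<^sub>F x in at_top. (E has_real_derivative \<alpha> x * E x) (at x)"
  shows "\<exists>K'. hardy_field K' \<and> K \<subseteq> K' \<and> y \<in> K'"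
proof -
  interpret hardy_field_extension K y E \<alpha> \<beta> by unfold_locales (use assms in auto)
  show ?thesis using hardy_field_adjoin subset_adjoin generator_in_adjoin by blast
qed

section \<open>Logarithmico-exponential functions inside Hardy fields\<close>

lemma hardy_field_constants: "hardy_field {f. \<exists>c. \<forall>\<^sub>F x in at_top. f x = c}"
proof
  fix f g :: "real \<Rightarrow> real"
  assume "f \<in> {f. \<exists>c. \<forall>\<^sub>F x in at_top. f x = c}" "g \<in> {f. \<exists>c. \<forall>\<^sub>F x in at_top. f x = c}"
  then obtain c d where cd: "\<forall>\<^sub>F x in at_top. f x = c" "\<forall>\<^sub>F x in at_top. g x = d" by auto
  have "\<forall>\<^sub>F x in at_top. f x + g x = c + d" "\<forall>\<^sub>F x in at_top. f x * g x = c * d"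
    using cd by (eventually_elim, simp)+
  then show "(\<lambda>x. f x + g x) \<in> {f. \<exists>c. \<forall>\<^sub>F x in at_top. f x = c}"
    "(\<lambda>x. f x * g x) \<in> {f. \<exists>c. \<forall>\<^sub>F x in at_top. f x = c}" by blast+
next
  fix f :: "real \<Rightarrow> real"
  assume "f \<in> {f. \<exists>c. \<forall>\<^sub>F x in at_top. f x = c}"
  then obtain c where c: "\<forall>\<^sub>F x in at_top. f x = c" by auto
  then have "\<forall>\<^sub>F x in at_top. inverse (f x) = inverse c" by eventually_elim simp
  then show "(\<lambda>x. inverse (f x)) \<in> {f. \<exists>c. \<forall>\<^sub>F x in at_top. f x = c}" by blast
  show "(\<forall>\<^sub>F x in at_top. f x = 0) \<or> (\<forall>\<^sub>F x in at_top. f x \<noteq> 0)"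
    using c by (rule eventually_zero_or_nonzero_of_const)
  have "\<forall>\<^sub>F x::real in at_top. ((\<lambda>_. c) has_vector_derivative 0) (at x)" by simp
  then have "\<forall>\<^sub>F x in at_top. (f has_vector_derivative 0) (at x)"
    by (rule eventually_at_top_deriv_cong) (rule c)
  then show "\<exists>f'\<in>{f. \<exists>c. \<forall>\<^sub>F x in at_top. f x = c}.
      \<forall>\<^sub>F x in at_top. (f has_real_derivative f' x) (at x)"
    by (intro bexI[of _ "\<lambda>_. 0"]) (auto simp: has_real_derivative_iff_has_vector_derivative)
next
  fix f g :: "real \<Rightarrow> real"
  assume "f \<in> {f. \<exists>c. \<forall>\<^sub>F x in at_top. f x = c}" and eq: "\<forall>\<^sub>F x in at_top. g x = f x"
  then obtain c where c: "\<forall>\<^sub>F x in at_top. f x = c" by auto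
  with eq have "\<forall>\<^sub>F x in at_top. g x = c" by eventually_elim simp
  then show "g \<in> {f. \<exists>c. \<forall>\<^sub>F x in at_top. f x = c}" by blast
qed auto

text \<open>The field \<open>K\<close> stays arbitrary in the induction: in the binary cases the
  second operand is put into an extension of the field that already contains the first. Separately
  chosen Hardy fields need not have a common extension.\<close>

lemma LE_in_hardy_field:
  assumes "f \<in> LE" "hardy_field K"
  shows "\<exists>K'. hardy_field K' \<and> K \<subseteq> K' \<and> f \<in> K'"
  using assms
proof (induction arbitrary: K)
  case ident
  then interpret hardy_field K by simp
  show ?case
    by (rule hardy_field_extension_ex[of "\<lambda>_. 0" "\<lambda>_. 1" _ "\<lambda>_. 1"]) (auto intro: const)
next
  case (const c)
  then interpret hardy_field K by simp
  show ?case using const hardy_field_axioms by blast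
next
  case (add f g)
  from add.IH(1)[OF add.prems] obtain K1 where K1: "hardy_field K1" "K \<subseteq> K1" "f \<in> K1" by blast
  from add.IH(2)[OF K1(1)] obtain K2 where K2: "hardy_field K2" "K1 \<subseteq> K2" "g \<in> K2" by blast
  show ?case using hardy_field.add[OF K2(1)] K1 K2 by blast
next
  case (diff f g)
  from diff.IH(1)[OF diff.prems] obtain K1 where K1: "hardy_field K1" "K \<subseteq> K1" "f \<in> K1" by blast
  from diff.IH(2)[OF K1(1)] obtain K2 where K2: "hardy_field K2" "K1 \<subseteq> K2" "g \<in> K2" by blast
  show ?case using hardy_field.diff[OF K2(1)] K1 K2 by blast
next
  case (mult f g)
  from mult.IH(1)[OF mult.prems] obtain K1 where K1: "hardy_field K1" "K \<subseteq> K1" "f \<in> K1" by blast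
  from mult.IH(2)[OF K1(1)] obtain K2 where K2: "hardy_field K2" "K1 \<subseteq> K2" "g \<in> K2" by blast
  show ?case using hardy_field.mult[OF K2(1)] K1 K2 by blast
next
  case (divide f g)
  from divide.IH(1)[OF divide.prems] obtain K1 where K1: "hardy_field K1" "K \<subseteq> K1" "f \<in> K1" by blast
  from divide.IH(2)[OF K1(1)] obtain K2 where K2: "hardy_field K2" "K1 \<subseteq> K2" "g \<in> K2" by blast
  show ?case using hardy_field.divide[OF K2(1)] K1 K2 by blast
next
  case (exp f)
  from exp.IH[OF exp.prems] obtain K1 where K1: "hardy_field K1" "K \<subseteq> K1" "f \<in> K1" by blast
  interpret hardy_field K1 by (rule K1)
  obtain f' where f': "f' \<in> K1" "\<forall>\<^sub>F x in at_top. (f has_real_derivative f' x) (at x)"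
    using deriv[OF K1(3)] by blast
  have d: "\<forall>\<^sub>F x in at_top. ((\<lambda>x. exp (f x)) has_real_derivative f' x * exp (f x)) (at x)"
    using f'(2) by eventually_elim (auto intro!: derivative_eq_intros)
  have "\<exists>K'. hardy_field K' \<and> K1 \<subseteq> K' \<and> (\<lambda>x. exp (f x)) \<in> K'"
    by (rule hardy_field_extension_ex[of f' "\<lambda>_. 0" _ "\<lambda>x. exp (f x)"])
       (use f' d const in auto)
  then show ?case using K1 by blast
next
  case (ln f)
  from ln.IH[OF ln.prems] obtain K1 where K1: "hardy_field K1" "K \<subseteq> K1" "f \<in> K1" by blast
  interpret hardy_field K1 by (rule K1)
  obtain f' where f': "f' \<in> K1" "\<forall>\<^sub>F x in at_top. (f has_real_derivative f' x) (at x)"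
    using deriv[OF K1(3)] by blast
  have d: "\<forall>\<^sub>F x in at_top. ((\<lambda>x. ln (f x)) has_real_derivative f' x / f x) (at x)"
    using f'(2) ln.hyps(2) by eventually_elim (auto intro!: derivative_eq_intros)
  have "\<exists>K'. hardy_field K' \<and> K1 \<subseteq> K' \<and> (\<lambda>x. ln (f x)) \<in> K'"
    by (rule hardy_field_extension_ex[of "\<lambda>_. 0" "\<lambda>x. f' x / f x" _ "\<lambda>_. 1"])
       (use f' d const K1 in \<open>auto intro: divide\<close>)
  then show ?case using K1 by blast
qed

lemma finite_LE_in_hardy_field:
  assumes "finite S" "S \<subseteq> LE"
  shows "\<exists>K. hardy_field K \<and> S \<subseteq> K"
  using assms
proof (induction S)
  case empty
  then show ?case using hardy_field_constants by blast
next
  case (insert f S)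
  then obtain K where "hardy_field K" "S \<subseteq> K" by blast
  with LE_in_hardy_field[of f K] insert.prems show ?case by blast
qed

text \<open>The Fourier side involves \<psi> at \<open>x / l\<close>, so dilates must stay in
  \<open>LE\<close>. The side conditions survive because \<open>a * x\<close> tends to
  infinity.\<close>

lemma LE_dilate:
  assumes "f \<in> LE" "a > 0"
  shows "(\<lambda>x. f (a * x)) \<in> LE"
proof -
  have ev: "\<forall>\<^sub>F x in at_top. P (a * x)" if "\<forall>\<^sub>F x in at_top. P x" for P :: "real \<Rightarrow> bool"
  proof -
    have "filterlim (\<lambda>x. a * x) at_top at_top"
      using assms(2) by (intro filterlim_tendsto_pos_mult_at_top[OF tendsto_const _ filterlim_ident]) auto
    with that show ?thesis by (rule eventually_compose_filterlim)
  qed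
  from assms(1) show ?thesis
  proof induction
    case ident
    show ?case by (rule LE.mult[OF LE.const LE.ident])
  qed (auto intro: LE.intros ev)
qed

section \<open>Independence of imaginary exponentials over a Hardy field\<close>

lemma has_vector_derivative_cis:
  "((\<lambda>x. cis (c * x)) has_vector_derivative \<i> * of_real c * cis (c * x)) (at x within S)"
  by (auto simp: has_vector_derivative_complex_iff intro!: derivative_eq_intros)

context hardy_field
begin

definition complexified :: "(real \<Rightarrow> complex) set" where
  "complexified = {G. (\<lambda>x. Re (G x)) \<in> K \<and> (\<lambda>x. Im (G x)) \<in> K}"

lemma complexified_of_real: "f \<in> K \<Longrightarrow> (\<lambda>x. complex_of_real (f x)) \<in> complexified"
  using const[of 0] by (simp add: complexified_def)

lemma complexified_const: "(\<lambda>_. c) \<in> complexified"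
  using const by (simp add: complexified_def)

lemma complexified_add:
  "F \<in> complexified \<Longrightarrow> G \<in> complexified \<Longrightarrow> (\<lambda>x. F x + G x) \<in> complexified"
  by (auto simp: complexified_def intro: add)

lemma complexified_mult:
  "F \<in> complexified \<Longrightarrow> G \<in> complexified \<Longrightarrow> (\<lambda>x. F x * G x) \<in> complexified"
  by (auto simp: complexified_def intro!: add diff mult)

lemma complexified_inverse: "F \<in> complexified \<Longrightarrow> (\<lambda>x. inverse (F x)) \<in> complexified"
  by (auto simp: complexified_def power2_eq_square intro!: divide uminus add mult)

lemma complexified_sum:
  "(\<And>i. i \<in> A \<Longrightarrow> F i \<in> complexified) \<Longrightarrow> (\<lambda>x. \<Sum>i\<in>A. F i x) \<in> complexified"
  by (induction A rule: infinite_finite_induct) (auto intro: complexified_const complexified_add)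

lemma complexified_zero_or_nonzero:
  assumes "G \<in> complexified"
  shows "(\<forall>\<^sub>F x in at_top. G x = 0) \<or> (\<forall>\<^sub>F x in at_top. G x \<noteq> 0)"
proof -
  have K: "(\<lambda>x. Re (G x)) \<in> K" "(\<lambda>x. Im (G x)) \<in> K" using assms by (auto simp: complexified_def)
  show ?thesis
  proof (cases "(\<forall>\<^sub>F x in at_top. Re (G x) = 0) \<and> (\<forall>\<^sub>F x in at_top. Im (G x) = 0)")
    case True
    then have "\<forall>\<^sub>F x in at_top. Re (G x) = 0 \<and> Im (G x) = 0" by (simp add: eventually_conj_iff)
    then have "\<forall>\<^sub>F x in at_top. G x = 0" by eventually_elim (simp add: complex_eq_iff)
    then show ?thesis ..
  next
    case False
    then consider "\<forall>\<^sub>F x in at_top. Re (G x) \<noteq> 0" | "\<forall>\<^sub>F x in at_top. Im (G x) \<noteq> 0"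
      using K[THEN zero_or_nonzero] by blast
    then have "\<forall>\<^sub>F x in at_top. G x \<noteq> 0"
      by cases (auto elim!: eventually_mono)
    then show ?thesis ..
  qed
qed

lemma complexified_deriv:
  assumes "G \<in> complexified"
  obtains G' where "G' \<in> complexified" "\<forall>\<^sub>F x in at_top. (G has_vector_derivative G' x) (at x)"
proof -
  have K: "(\<lambda>x. Re (G x)) \<in> K" "(\<lambda>x. Im (G x)) \<in> K" using assms by (auto simp: complexified_def)
  obtain u' where u': "u' \<in> K" "\<forall>\<^sub>F x in at_top. ((\<lambda>x. Re (G x)) has_real_derivative u' x) (at x)"
    using deriv[OF K(1)] by blast
  obtain v' where v': "v' \<in> K" "\<forall>\<^sub>F x in at_top. ((\<lambda>x. Im (G x)) has_real_derivative v' x) (at x)"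
    using deriv[OF K(2)] by blast
  show thesis
  proof
    show "(\<lambda>x. Complex (u' x) (v' x)) \<in> complexified" using u' v' by (simp add: complexified_def)
    show "\<forall>\<^sub>F x in at_top. (G has_vector_derivative Complex (u' x) (v' x)) (at x)"
      using u'(2) v'(2)
    proof eventually_elim
      case (elim x)
      then show ?case
        by (simp add: has_vector_derivative_complex_iff has_real_derivative_iff_has_vector_derivative)
    qed
  qed
qed

text \<open>Such an \<open>H\<close> is a constant times \<open>cis (\<omega> * x)\<close>, so its
  real part changes sign over every half period. A Hardy field allows this only if the real part is
  eventually zero; differentiating the real part then shows that \<omega> times the imaginary part
  is zero as well.\<close>

lemma no_oscillation:
  assumes H: "H \<in> complexified" and "\<omega> \<noteq> 0"
    and deriv: "\<forall>\<^sub>F x in at_top. (H has_vector_derivative \<i> * of_real \<omega> * H x) (at x)"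
  shows "\<forall>\<^sub>F x in at_top. H x = 0"
proof -
  obtain A where A: "\<And>x. x \<ge> A \<Longrightarrow> (H has_vector_derivative \<i> * of_real \<omega> * H x) (at x)"
    using deriv by (auto simp: eventually_at_top_linorder)
  have "(\<lambda>x. Re (H x)) \<in> K" using H by (simp add: complexified_def)
  from zero_or_nonzero[OF this] show ?thesis
  proof
    assume z: "\<forall>\<^sub>F x in at_top. Re (H x) = 0"
    have "\<forall>\<^sub>F x::real in at_top. ((\<lambda>_. 0::real) has_vector_derivative 0) (at x)" by simp
    then have "\<forall>\<^sub>F x in at_top. ((\<lambda>x. Re (H x)) has_vector_derivative 0) (at x)"
      by (rule eventually_at_top_deriv_cong) (rule z)
    with deriv z show ?thesis
    proof eventually_elim
      case (elim x)
      have "((\<lambda>x. Re (H x)) has_vector_derivative Re (\<i> * of_real \<omega> * H x)) (at x)"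
        using elim(1) by (simp add: has_vector_derivative_complex_iff has_real_derivative_iff_has_vector_derivative)
      from vector_derivative_unique_at[OF this elim(3)] have "Im (H x) = 0" using \<open>\<omega> \<noteq> 0\<close> by simp
      then show ?case using elim(2) by (simp add: complex_eq_iff)
    qed
  next
    assume nz: "\<forall>\<^sub>F x in at_top. Re (H x) \<noteq> 0"
    then obtain A' where A': "\<And>x. x \<ge> A' \<Longrightarrow> Re (H x) \<noteq> 0"
      by (auto simp: eventually_at_top_linorder)
    define B where "B = max A A'"
    have "((\<lambda>x. cis (- \<omega> * x) * H x) has_vector_derivative 0) (at x)" if "x \<ge> B" for x
      using has_vector_derivative_mult[OF has_vector_derivative_cis[of "-\<omega>"] A[of x]] that
      by (simp add: B_def)
    then have d: "((\<lambda>x. cis (- \<omega> * x) * H x) has_vector_derivative 0) (at x within {B..})"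
      if "x \<in> {B..}" for x
      using that by (auto intro: has_vector_derivative_at_within)
    obtain C where const: "\<And>x. x \<in> {B..} \<Longrightarrow> cis (- \<omega> * x) * H x = C"
      using has_vector_derivative_zero_constant[OF _ d] by auto
    have Heq: "H x = C * cis (\<omega> * x)" if "x \<ge> B" for x
    proof -
      have "C * cis (\<omega> * x) = (cis (- \<omega> * x) * cis (\<omega> * x)) * H x"
        using const[of x] that by (simp add: mult_ac)
      then show ?thesis by (simp add: cis_mult)
    qed
    define p where "p = pi / \<bar>\<omega>\<bar>"
    have p: "p > 0" using \<open>\<omega> \<noteq> 0\<close> by (simp add: p_def)
    have "cis (\<omega> * (B + p)) = - cis (\<omega> * B)"
      using \<open>\<omega> \<noteq> 0\<close> by (cases "\<omega> > 0") (auto simp: p_def algebra_simps complex_eq_iff cos_diff sin_diff)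
    then have neg: "Re (H (B + p)) = - Re (H B)"
      using Heq[of B] Heq[of "B + p"] p by simp
    have cont: "continuous_on {B..B+p} (\<lambda>x. Re (H x))"
      by (intro continuous_on_Re continuous_at_imp_continuous_on ballI)
         (auto intro!: has_vector_derivative_continuous[OF A] simp: B_def)
    have "\<exists>x. B \<le> x \<and> x \<le> B + p \<and> Re (H x) = 0"
    proof (cases "Re (H B) \<le> 0")
      case True
      then show ?thesis using IVT'[of "\<lambda>x. Re (H x)" B 0 "B + p"] cont neg p by auto
    next
      case False
      then show ?thesis using IVT2'[of "\<lambda>x. Re (H x)" "B + p" 0 B] cont neg p by auto
    qed
    then show ?thesis using A' by (auto simp: B_def)
  qed
qed

text \<open>Induction on the number of frequencies, by normalizing one term to a constant and
  differentiating it away. Dividing by \<open>cis (c * x) * G c x\<close> leaves a sum equal to -1;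
  its derivative is a relation with one frequency fewer, and the vanishing of the new coefficients
  is a first-order equation for each \<open>H b\<close>, to which \<open>no_oscillation\<close>
  applies. That all \<open>H b\<close> are zero contradicts the value -1.\<close>

lemma exponentials_independent:
  assumes "finite B" "\<And>b. b \<in> B \<Longrightarrow> G b \<in> complexified"
    and "\<forall>\<^sub>F x in at_top. (\<Sum>b\<in>B. cis (b * x) * G b x) = 0"
  shows "\<forall>b\<in>B. \<forall>\<^sub>F x in at_top. G b x = 0"
  using assms
proof (induction B arbitrary: G)
  case (insert c B)
  show ?case
  proof (cases "\<forall>\<^sub>F x in at_top. G c x = 0")
    case True
    with insert.prems(2) have "\<forall>\<^sub>F x in at_top. (\<Sum>b\<in>B. cis (b * x) * G b x) = 0"
      by eventually_elim (use insert.hyps in simp)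
    then show ?thesis using insert.IH[of G] insert.prems(1) True by auto
  next
    case False
    then have nz: "\<forall>\<^sub>F x in at_top. G c x \<noteq> 0"
      using complexified_zero_or_nonzero[of "G c"] insert.prems(1) by blast
    define H where "H = (\<lambda>b x. G b x * inverse (G c x))"
    have H: "H b \<in> complexified" if "b \<in> B" for b
      unfolding H_def using insert.prems(1) that by (intro complexified_mult complexified_inverse) auto
    have "\<forall>b\<in>B. \<exists>H'. H' \<in> complexified \<and> (\<forall>\<^sub>F x in at_top. (H b has_vector_derivative H' x) (at x))"
      using complexified_deriv[OF H] by blast
    then obtain H' where H': "\<And>b. b \<in> B \<Longrightarrow> H' b \<in> complexified"
      "\<And>b. b \<in> B \<Longrightarrow> \<forall>\<^sub>F x in at_top. (H b has_vector_derivative H' b x) (at x)"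
      by metis
    have sum_eq: "\<forall>\<^sub>F x in at_top. (\<Sum>b\<in>B. cis ((b - c) * x) * H b x) = - 1"
      using insert.prems(2) nz
    proof eventually_elim
      case (elim x)
      have "(\<Sum>b\<in>B. cis ((b - c) * x) * H b x)
          = inverse (cis (c * x) * G c x) * (\<Sum>b\<in>B. cis (b * x) * G b x)"
        unfolding sum_distrib_left
        by (intro sum.cong) (auto simp: H_def left_diff_distrib cis_divide[symmetric] divide_inverse)
      also have "(\<Sum>b\<in>B. cis (b * x) * G b x) = - (cis (c * x) * G c x)"
        using elim(1) insert.hyps by (simp add: add_eq_0_iff)
      finally show ?case using elim(2) by (simp add: field_simps)
    qed
    have d1: "\<forall>\<^sub>F x in at_top. ((\<lambda>x. \<Sum>b\<in>B. cis ((b - c) * x) * H b x) has_vector_derivative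
        (\<Sum>b\<in>B. cis ((b - c) * x) * (H' b x + \<i> * of_real (b - c) * H b x))) (at x)"
    proof -
      have "\<forall>\<^sub>F x in at_top. \<forall>b\<in>B. (H b has_vector_derivative H' b x) (at x)"
        using H' insert.hyps by (intro eventually_ball_finite) auto
      then show ?thesis
      proof eventually_elim
        case (elim x)
        show ?case
        proof (rule has_vector_derivative_sum)
          fix b assume "b \<in> B"
          with elim have "(H b has_vector_derivative H' b x) (at x)" by blast
          from has_vector_derivative_mult[OF has_vector_derivative_cis[of "b - c"] this]
          show "((\<lambda>x. cis ((b - c) * x) * H b x) has_vector_derivative
              cis ((b - c) * x) * (H' b x + \<i> * of_real (b - c) * H b x)) (at x)"
            by (simp add: algebra_simps)
        qed
      qed
    qed
    have "\<forall>\<^sub>F x::real in at_top. ((\<lambda>_. - 1 :: complex) has_vector_derivative 0) (at x)" by simp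
    then have d2: "\<forall>\<^sub>F x in at_top.
        ((\<lambda>x. \<Sum>b\<in>B. cis ((b - c) * x) * H b x) has_vector_derivative 0) (at x)"
      by (rule eventually_at_top_deriv_cong) (rule sum_eq)
    \<comment> \<open>Multiplying back by \<open>cis (c * x)\<close> restores the frequencies in
      \<open>B\<close>, for which the induction hypothesis allows arbitrary coefficients.\<close>
    have "\<forall>\<^sub>F x in at_top. (\<Sum>b\<in>B. cis (b * x) * (H' b x + \<i> * of_real (b - c) * H b x)) = 0"
      using d1 d2
    proof eventually_elim
      case (elim x)
      have "(\<Sum>b\<in>B. cis (b * x) * (H' b x + \<i> * of_real (b - c) * H b x))
        = cis (c * x) * (\<Sum>b\<in>B. cis ((b - c) * x) * (H' b x + \<i> * of_real (b - c) * H b x))"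
        unfolding sum_distrib_left
        by (intro sum.cong) (auto simp: left_diff_distrib cis_divide[symmetric])
      then show ?case using vector_derivative_unique_at[OF elim] by simp
    qed
    then have ode: "\<forall>b\<in>B. \<forall>\<^sub>F x in at_top. H' b x + \<i> * of_real (b - c) * H b x = 0"
      using H H' by (intro insert.IH complexified_add complexified_mult complexified_const) auto
    have "\<forall>\<^sub>F x in at_top. H b x = 0" if "b \<in> B" for b
    proof (rule no_oscillation[OF H[OF that], of "c - b"])
      show "c - b \<noteq> 0" using insert.hyps that by auto
      have "\<forall>\<^sub>F x in at_top. (H b has_vector_derivative H' b x) (at x)" using H' that by blast
      with ode[rule_format, OF that]
      show "\<forall>\<^sub>F x in at_top. (H b has_vector_derivative \<i> * complex_of_real (c - b) * H b x) (at x)"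
      proof eventually_elim
        case (elim x)
        from elim(1) have "H' b x = \<i> * complex_of_real (c - b) * H b x"
          by (simp add: algebra_simps add_eq_0_iff)
        then show ?case using elim(2) by simp
      qed
    qed
    then have "\<forall>\<^sub>F x in at_top. \<forall>b\<in>B. H b x = 0"
      using insert.hyps by (intro eventually_ball_finite) auto
    with sum_eq have "\<forall>\<^sub>F x::real in at_top. False" by eventually_elim simp
    then show ?thesis by simp
  qed
qed simp

end

section \<open>Dilation operators and the ends of supports\<close>

text \<open>The sum extends to an entire function, which has finitely many zeros in a compact set
  unless it is constant. A constant value is not zero, by independence of the exponentials over the
  constants.\<close>

lemma trig_poly_finite_zeros:
  fixes d :: "real \<Rightarrow> complex"
  assumes "finite T" "\<sigma> \<in> T" "d \<sigma> \<noteq> 0"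
  shows "finite {x \<in> {a..b}. (\<Sum>\<tau>\<in>T. d \<tau> * cis (\<tau> * x)) = 0}"
proof -
  define F where "F = (\<lambda>z. \<Sum>\<tau>\<in>T. d \<tau> * exp (\<i> * of_real \<tau> * z))"
  have F: "F (of_real x) = (\<Sum>\<tau>\<in>T. d \<tau> * cis (\<tau> * x))" for x
    by (simp add: F_def cis_conv_exp mult_ac)
  show ?thesis
  proof (cases "F constant_on UNIV")
    case True
    then obtain c where c: "\<And>z. F z = c" by (auto simp: constant_on_def)
    interpret hardy_field "{f. \<exists>c. \<forall>\<^sub>F x in at_top. f x = c}" by (rule hardy_field_constants)
    have "c \<noteq> 0"
    proof
      assume "c = 0"
      then have "\<forall>\<^sub>F x in at_top. (\<Sum>\<tau>\<in>T. cis (\<tau> * x) * d \<tau>) = 0"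
        using c F by (simp add: mult.commute)
      from exponentials_independent[OF assms(1) _ this] have "\<forall>\<^sub>F x::real in at_top. d \<sigma> = 0"
        using assms(2) complexified_const by blast
      then show False using assms(3) by simp
    qed
    then show ?thesis by (simp flip: F add: c)
  next
    case False
    have "F holomorphic_on UNIV" unfolding F_def by (intro holomorphic_intros)
    moreover have "compact (complex_of_real ` {a..b})"
      by (intro compact_continuous_image continuous_intros) auto
    ultimately have fin: "finite {z \<in> complex_of_real ` {a..b}. F z = 0}"
      using False by (intro holomorphic_compact_finite_zeros[of F UNIV]) auto
    have "complex_of_real ` {x \<in> {a..b}. F (of_real x) = 0} \<subseteq> {z \<in> complex_of_real ` {a..b}. F z = 0}"
      by blast
    from finite_subset[OF this fin] have "finite {x \<in> {a..b}. F (of_real x) = 0}"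
      by (rule finite_imageD) (auto simp: inj_on_def)
    then show ?thesis by (simp add: F)
  qed
qed

lemma AE_lborel_trig_poly_nonzero:
  fixes d :: "real \<Rightarrow> complex"
  assumes "finite T" "\<sigma> \<in> T" "d \<sigma> \<noteq> 0"
  shows "AE x in lborel. (\<Sum>\<tau>\<in>T. d \<tau> * cis (\<tau> * x)) \<noteq> 0"
proof -
  let ?Z = "\<Union>n::nat. {x \<in> {- real n..real n}. (\<Sum>\<tau>\<in>T. d \<tau> * cis (\<tau> * x)) = 0}"
  have "countable ?Z"
    by (rule countable_UN, simp) (rule countable_finite, rule trig_poly_finite_zeros[where d = d, OF assms])
  then have "?Z \<in> null_sets lborel" by (rule countable_imp_null_set_lborel)
  moreover have "x \<in> ?Z" if "(\<Sum>\<tau>\<in>T. d \<tau> * cis (\<tau> * x)) = 0" for x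
  proof -
    obtain n :: nat where "\<bar>x\<bar> \<le> real n" using real_arch_simple by blast
    then have "x \<in> {- real n..real n}" by auto
    with that show ?thesis by blast
  qed
  ultimately show ?thesis by (intro AE_I'[of ?Z]) auto
qed

text \<open>\<open>P\<close> need not be measurable, so the transport under the affine map is done
  for a Borel null set that contains its exceptions.\<close>

lemma AE_lborel_affine:
  fixes P :: "real \<Rightarrow> bool"
  assumes "AE x in lborel. P x" "c \<noteq> 0"
  shows "AE x in lborel. P (t + c * x)"
proof -
  obtain N where N: "N \<in> null_sets lborel" "{x. \<not> P x} \<subseteq> N"
    using assms(1) unfolding eventually_ae_filter by auto
  have "AE x in lborel. x \<notin> N" by (rule AE_not_in[OF N(1)])
  moreover have "Measurable.pred borel (\<lambda>x. x \<notin> N)"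
    using N(1) by (auto simp: null_sets_def)
  ultimately have "AE x in lborel. t + c * x \<notin> N"
    using AE_borel_affine[OF assms(2), of "\<lambda>x. x \<notin> N" t] by blast
  then show ?thesis by eventually_elim (use N(2) in auto)
qed

lemma AE_lborel_dilate:
  fixes P :: "real \<Rightarrow> bool"
  assumes "AE x in lborel. P x" "c \<noteq> 0"
  shows "AE x in lborel. P (x * c)" "AE x in lborel. P (x / c)"
  using AE_lborel_affine[OF assms(1), of c 0] AE_lborel_affine[OF assms(1), of "inverse c" 0] assms(2)
  by (simp_all add: divide_inverse mult.commute)

text \<open>The ratio is the factor gained in each descent step of
  \<open>dilation_comb_eventually_zero_imp_zero\<close>.\<close>

lemma finite_gap_ratio:
  fixes L :: "real set"
  assumes "finite L" "L \<subseteq> {0<..}"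
  obtains \<rho> where "\<rho> > 1" "\<And>l u. l \<in> L \<Longrightarrow> u \<in> L \<Longrightarrow> l < u \<Longrightarrow> \<rho> * l \<le> u"
proof -
  \<comment> \<open>The element 2 keeps \<open>R\<close> nonempty when \<open>L\<close> has fewer
    than two elements.\<close>
  define R where "R = insert 2 ((\<lambda>(l, u). u / l) ` {(l, u) \<in> L \<times> L. l < u})"
  have "finite {(l, u) \<in> L \<times> L. l < u}"
    by (rule finite_subset[of _ "L \<times> L"]) (use assms in blast, use assms in simp)
  then have R: "finite R" "R \<noteq> {}" by (auto simp: R_def)
  have "\<forall>r\<in>R. r > 1" using assms by (auto simp: R_def)
  show thesis
  proof
    show "Min R > 1" using R \<open>\<forall>r\<in>R. r > 1\<close> by simp
    fix l u assume "l \<in> L" "u \<in> L" "l < u"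
    then have "Min R \<le> u / l" using R by (intro Min_le) (auto simp: R_def)
    then show "Min R * l \<le> u" using \<open>l \<in> L\<close> assms(2) by (auto simp: field_simps)
  qed
qed

text \<open>The argument is \<open>x / l\<close> because a dilation by \<open>l\<close> becomes one
  by the inverse of \<open>l\<close> under the Fourier transform.\<close>

definition dilation_comb :: "real set \<Rightarrow> (real \<Rightarrow> complex) \<Rightarrow> (real \<Rightarrow> complex) \<Rightarrow> real \<Rightarrow> complex" where
  "dilation_comb L c f x = (\<Sum>l\<in>L. c l * f (x / l))"

lemma dilation_comb_commute:
  "dilation_comb L c (dilation_comb L d f) x = dilation_comb L d (dilation_comb L c f) x"
proof -
  have "dilation_comb L c (dilation_comb L d f) x = (\<Sum>l\<in>L. \<Sum>u\<in>L. c l * d u * f (x / (l * u)))"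
    by (simp add: dilation_comb_def sum_distrib_left mult.assoc)
  also have "\<dots> = (\<Sum>u\<in>L. \<Sum>l\<in>L. c l * d u * f (x / (l * u)))"
    by (rule sum.swap)
  also have "\<dots> = dilation_comb L d (dilation_comb L c f) x"
    by (simp add: dilation_comb_def sum_distrib_left mult_ac)
  finally show ?thesis .
qed

text \<open>
  If \<open>m b\<close> denotes the largest dilation occurring in the operator of \<open>b\<close>, the supports of the
  functions \<open>w b\<close> end at points proportional to \<open>m b\<close>, because the operators commute. Hence
  near the common endpoint only the \<open>w b\<close> with maximal \<open>m b\<close> survive in the relation, and these are
  proportional there; so a trigonometric polynomial times one of them vanishes.
\<close>

lemma dilation_comb_eventually_zero_imp_zero:
  fixes f :: "real \<Rightarrow> complex" and C :: "real \<Rightarrow> real \<Rightarrow> complex"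
  assumes fin: "finite B" "finite L" and L: "L \<subseteq> {0<..}"
    and rel: "AE x in lborel. x > 0 \<longrightarrow> (\<Sum>b\<in>B. cis (b * x) * dilation_comb L (C b) f x) = 0"
    and ev: "\<And>b. b \<in> B \<Longrightarrow> AE x in lborel. x > A \<longrightarrow> dilation_comb L (C b) f x = 0"
    and b: "b \<in> B"
  shows "AE x in lborel. x > 0 \<longrightarrow> dilation_comb L (C b) f x = 0"
proof -
  define w where "w b = dilation_comb L (C b) f" for b
  define S where "S b = {l\<in>L. C b l \<noteq> 0}" for b
  define m where "m b = Max (S b)" for b
  define B' where "B' = {b\<in>B. S b \<noteq> {}}"
  have finS: "finite (S b)" for b using fin by (simp add: S_def)
  have finB': "finite B'" using fin by (simp add: B'_def)
  have w0: "w b x = 0" if "b \<notin> B'" "b \<in> B" for b x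
    using that by (auto simp: w_def dilation_comb_def B'_def S_def)
  have m: "m b \<in> S b" if "b \<in> B'" for b
    unfolding m_def using that finS by (intro Max_in) (auto simp: B'_def)
  then have mL: "m b \<in> L" and mpos: "m b > 0" and Cm: "C b (m b) \<noteq> 0" if "b \<in> B'" for b
    using that L by (auto simp: S_def)
  have mmax: "l \<le> m b" if "l \<in> S b" for b l unfolding m_def using that finS by simp
  obtain \<rho> where \<rho>: "\<rho> > 1" "\<And>l u. l \<in> L \<Longrightarrow> u \<in> L \<Longrightarrow> l < u \<Longrightarrow> \<rho> * l \<le> u"
    using finite_gap_ratio[OF fin(2) L] by blast
  \<comment> \<open>A single parameter \<open>s\<close> bounds all supports, each scaled by its own
    \<open>m b\<close>; the aim is to let \<open>s\<close> tend to 0.\<close>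
  define Z where "Z s \<longleftrightarrow> (\<forall>b\<in>B'. AE x in lborel. x > s * m b \<longrightarrow> w b x = 0)" for s
  \<comment> \<open>Just below the end of the support only the largest dilation is felt: any other
    \<open>l\<close> with nonzero coefficient satisfies \<open>\<rho> * l \<le> m b\<close>, so
    \<open>x / l\<close> lies beyond \<open>t\<close>, where \<open>g\<close> vanishes.\<close>
  have top: "dilation_comb L (C b) g x = C b (m b) * g (x / m b)"
    if b: "b \<in> B'" and x: "x > t * m b / \<rho>" and "t > 0"
      and g: "\<And>l. l \<in> L \<Longrightarrow> x / l > t \<Longrightarrow> g (x / l) = 0" for b x t and g :: "real \<Rightarrow> complex"
  proof -
    have "C b l * g (x / l) = 0" if l: "l \<in> L - {m b}" for l
    proof (cases "l \<in> S b")
      case True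
      then have "l < m b" using mmax[of l b] l by auto
      then have le: "\<rho> * l \<le> m b" using \<rho>(2) mL[OF b] l by auto
      have lpos: "l > 0" using l L by auto
      have "t * l \<le> t * m b / \<rho>"
        using le \<open>t > 0\<close> \<rho>(1) by (simp add: field_simps)
      also note x
      finally have "t < x / l" using lpos by (simp add: field_simps)
      then show ?thesis using g l by simp
    qed (use l in \<open>auto simp: S_def\<close>)
    then show ?thesis unfolding dilation_comb_def
      by (subst sum.remove[OF fin(2) mL[OF b]]) (simp add: sum.neutral)
  qed
  have step: "Z (s / \<rho>)" if Z: "Z s" and s: "s > 0" for s
  proof (cases "B' = {}")
    case False
    have zero: "AE x in lborel. \<forall>l\<in>L. x / l > s * m b \<longrightarrow> w b (x / l) = 0" if "b \<in> B'" for b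
    proof (intro AE_finite_allI fin)
      fix l assume "l \<in> L"
      then have "l \<noteq> 0" using L by auto
      with Z that show "AE x in lborel. x / l > s * m b \<longrightarrow> w b (x / l) = 0"
        unfolding Z_def by (intro AE_lborel_dilate(2)[of "\<lambda>x. x > s * m b \<longrightarrow> w b x = 0"]) auto
    qed
    \<comment> \<open>Both sides are the leading terms of the two orders of applying the operators
      of \<open>b\<close> and \<open>b'\<close> to \<open>f\<close>; the threshold is symmetric, so
      \<open>top\<close> applies to both.\<close>
    have comm: "AE x in lborel. x > s * m b * m b' / \<rho> \<longrightarrow>
        C b (m b) * w b' (x / m b) = C b' (m b') * w b (x / m b')"
      if "b \<in> B'" "b' \<in> B'" for b b'
      using zero[OF that(1)] zero[OF that(2)]
    proof eventually_elim
      case (elim x)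
      show ?case
      proof
        assume x: "x > s * m b * m b' / \<rho>"
        have "dilation_comb L (C b) (w b') x = C b (m b) * w b' (x / m b)"
          using that x s mpos elim(2) by (intro top[of b "s * m b'"]) (auto simp: mult_ac)
        moreover have "dilation_comb L (C b') (w b) x = C b' (m b') * w b (x / m b')"
          using that x s mpos elim(1) by (intro top[of b' "s * m b"]) auto
        ultimately show "C b (m b) * w b' (x / m b) = C b' (m b') * w b (x / m b')"
          using dilation_comb_commute[of L "C b" "C b'" f x] unfolding w_def by simp
      qed
    qed
    define M where "M = Max (m ` B')"
    have "M \<in> m ` B'" unfolding M_def using finB' False by (intro Max_in) auto
    then obtain k where k: "k \<in> B'" "m k = M" by auto
    have mM: "m b \<le> M" if "b \<in> B'" for b unfolding M_def using that finB' by simp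
    have Mpos: "M > 0" using mpos[OF k(1)] k(2) by simp
    have proportional: "AE x in lborel. \<forall>b\<in>B'. m b = M \<longrightarrow> x > s * M / \<rho> \<longrightarrow> C k M * w b x = C b M * w k x"
    proof (intro AE_finite_allI finB')
      fix b assume b: "b \<in> B'"
      show "AE x in lborel. m b = M \<longrightarrow> x > s * M / \<rho> \<longrightarrow> C k M * w b x = C b M * w k x"
        using AE_lborel_dilate(1)[OF comm[OF k(1) b], of M] Mpos mult_strict_right_mono[of "s * M / \<rho>" _ M]
        by (auto elim!: eventually_mono simp: k)
    qed
    have small: "AE x in lborel. \<forall>b\<in>B'. x > s * m b \<longrightarrow> w b x = 0"
      using Z finB' by (intro AE_finite_allI) (auto simp: Z_def)
    \<comment> \<open>Up to the factor \<open>w k x\<close>, these coefficients give what remains of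
      the relation after multiplication by \<open>C k M\<close>. The coefficient at \<open>k\<close>
      is not zero, so the trigonometric polynomial vanishes only on a null set.\<close>
    define d where "d b = (if b \<in> B' \<and> m b = M then C b M else 0)" for b
    have "AE x in lborel. (\<Sum>b\<in>B. d b * cis (b * x)) \<noteq> 0"
      by (rule AE_lborel_trig_poly_nonzero[OF fin(1), of k])
         (use k Cm[OF k(1)] in \<open>auto simp: d_def B'_def\<close>)
    with rel proportional small have wk: "AE x in lborel. x > s * M / \<rho> \<longrightarrow> w k x = 0"
    proof eventually_elim
      case (elim x)
      show ?case
      proof
        assume x: "x > s * M / \<rho>"
        moreover have "s * M / \<rho> > 0" using s Mpos \<rho>(1) by simp
        ultimately have x0: "x > 0" by linarith
        have "C k M * (cis (b * x) * w b x) = d b * cis (b * x) * w k x" if "b \<in> B" for b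
        proof (cases "b \<in> B'")
          case True
          show ?thesis
          proof (cases "m b = M")
            case True
            then have "C k M * w b x = C b M * w k x" using elim(2) x \<open>b \<in> B'\<close> by blast
            then show ?thesis using True \<open>b \<in> B'\<close> by (simp add: d_def mult_ac)
          next
            case False
            then have "m b < m k" using mM[OF True] k by simp
            \<comment> \<open>By the gap, the support of this \<open>w b\<close> already ends below
              the range of \<open>x\<close> under consideration.\<close>
            then have "\<rho> * m b \<le> M" using \<rho>(2) mL k True by auto
            then have "s * m b \<le> s * M / \<rho>" using s \<rho>(1) by (simp add: field_simps)
            then have "w b x = 0" using x elim(3) True by auto
            then show ?thesis using False by (simp add: d_def)
          qed
        qed (use w0 that in \<open>simp add: d_def\<close>)
        then have "C k M * (\<Sum>b\<in>B. cis (b * x) * w b x) = (\<Sum>b\<in>B. d b * cis (b * x)) * w k x"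
          unfolding sum_distrib_left sum_distrib_right by (intro sum.cong) auto
        then show "w k x = 0" using elim(1,4) x0 by (simp add: w_def)
      qed
    qed
    show ?thesis unfolding Z_def
    proof
      fix b assume b: "b \<in> B'"
      have "m b \<noteq> 0" using mpos[OF b] by simp
      \<comment> \<open>The proportionality carries the improved end of the support of
        \<open>w k\<close> over to every \<open>w b\<close>, whether or not \<open>m b\<close> is
        maximal.\<close>
      from comm[OF b k(1)] AE_lborel_dilate(2)[OF wk this]
      have "AE x in lborel. x > s * m b * M / \<rho> \<longrightarrow> w b (x / M) = 0"
      proof eventually_elim
        case (elim x)
        show ?case
        proof
          assume x: "x > s * m b * M / \<rho>"
          then have "x / m b > s * M / \<rho>" using mpos[OF b] \<rho>(1) by (simp add: field_simps)
          then have "w k (x / m b) = 0" using elim by auto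
          then show "w b (x / M) = 0" using elim(1) x k Cm[OF k(1)] by auto
        qed
      qed
      from AE_lborel_dilate(1)[OF this, of M] Mpos mult_strict_right_mono[of "s / \<rho> * m b" _ M]
      show "AE x in lborel. x > s / \<rho> * m b \<longrightarrow> w b x = 0"
        by (auto elim!: eventually_mono)
    qed
  qed (simp add: Z_def)
  show ?thesis
  proof (cases "b \<in> B'")
    case True
    \<comment> \<open>The 1 makes \<open>s\<close> positive even if \<open>A\<close> is negative, as
      \<open>step\<close> requires.\<close>
    define s where "s = Max (insert 1 ((\<lambda>b. A / m b) ` B'))"
    have s: "s \<ge> 1" "\<And>b. b \<in> B' \<Longrightarrow> s \<ge> A / m b"
      unfolding s_def using finB' by (auto intro!: Max_ge)
    have "Z s" unfolding Z_def
    proof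
      fix b assume b': "b \<in> B'"
      then have "A \<le> s * m b" using s(2)[OF b'] mpos[OF b'] by (simp add: field_simps)
      then show "AE x in lborel. x > s * m b \<longrightarrow> w b x = 0"
        using ev[of b] b' by (auto elim!: eventually_mono simp: B'_def w_def)
    qed
    have "Z (s / \<rho> ^ n)" for n
    proof (induction n)
      case (Suc n)
      have "s / \<rho> ^ n > 0" using s \<rho>(1) by simp
      from step[OF Suc this] show ?case by (simp add: mult.commute)
    qed (simp add: \<open>Z s\<close>)
    then have "AE x in lborel. \<forall>n. x > s / \<rho> ^ n * m b \<longrightarrow> w b x = 0"
      using True unfolding AE_all_countable by (simp add: Z_def)
    then show ?thesis
    proof eventually_elim
      case (elim x)
      show ?case
      proof
        assume "x > 0"
        obtain n where "s * m b / x < \<rho> ^ n" using real_arch_pow[OF \<rho>(1)] by blast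
        then have "s / \<rho> ^ n * m b < x" using \<open>x > 0\<close> \<rho>(1) by (simp add: field_simps)
        then show "dilation_comb L (C b) f x = 0" using elim by (auto simp: w_def)
      qed
    qed
  qed (use w0 b in \<open>simp add: w_def\<close>)
qed

section \<open>Uniqueness for Fourier integrals and windowed exponentials\<close>

text \<open>The positive and negative parts of \<open>u\<close> have the same Fourier transform,
  hence by frequency 0 the same mass \<open>c\<close>. Unless \<open>c\<close> is 0, dividing by
  \<open>c\<close> gives probability densities, and Levy's uniqueness theorem identifies them; but
  the two parts are never positive at the same point.\<close>

lemma integrable_real_part_char_zero:
  fixes u :: "real \<Rightarrow> real"
  assumes u: "integrable lborel u"
    and zero: "\<And>\<xi>. (LINT t|lborel. of_real (u t) * cis (\<xi> * t)) = 0"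
  shows "AE t in lborel. u t = 0"
proof -
  define c where "c = (LINT t|lborel. max 0 (u t))"
  have m[measurable]: "u \<in> borel_measurable borel" using u by simp
  have ip: "integrable lborel (\<lambda>t. max 0 (u t))" "integrable lborel (\<lambda>t. max 0 (- u t))"
    using u by auto
  have cis_int: "integrable lborel (\<lambda>t. of_real (f t) * cis (\<xi> * t))" if "integrable lborel f" for f \<xi>
  proof (rule Bochner_Integration.integrable_bound[OF that])
    show "(\<lambda>t. complex_of_real (f t) * cis (\<xi> * t)) \<in> borel_measurable lborel"
      using that by (auto simp: cis_conv_exp)
  qed (auto simp: norm_mult)
  have eq: "(LINT t|lborel. of_real (max 0 (u t)) * cis (\<xi> * t))
      = (LINT t|lborel. of_real (max 0 (- u t)) * cis (\<xi> * t))" for \<xi>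
  proof -
    have "0 = (LINT t|lborel. of_real (u t) * cis (\<xi> * t))" using zero by simp
    also have "\<dots> = (LINT t|lborel. of_real (max 0 (u t)) * cis (\<xi> * t) - of_real (max 0 (- u t)) * cis (\<xi> * t))"
      by (intro Bochner_Integration.integral_cong) (auto simp: max_def algebra_simps)
    also have "\<dots> = (LINT t|lborel. of_real (max 0 (u t)) * cis (\<xi> * t))
        - (LINT t|lborel. of_real (max 0 (- u t)) * cis (\<xi> * t))"
      by (intro Bochner_Integration.integral_diff cis_int ip)
    finally show ?thesis by simp
  qed
  have c2: "(LINT t|lborel. max 0 (- u t)) = c"
  proof -
    have "complex_of_real (LINT t|lborel. max 0 (- u t)) = complex_of_real c"
      using eq[of 0] by (simp add: c_def flip: integral_complex_of_real)
    then show ?thesis by simp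
  qed
  have c0: "c \<ge> 0" unfolding c_def by (intro integral_nonneg_AE) auto
  show ?thesis
  proof (cases "c = 0")
    case True
    then have "AE t in lborel. max 0 (u t) = 0" "AE t in lborel. max 0 (- u t) = 0"
      using integral_nonneg_eq_0_iff_AE[OF ip(1)] integral_nonneg_eq_0_iff_AE[OF ip(2)] c2
      by (auto simp: c_def)
    then show ?thesis by eventually_elim (simp add: max_def split: if_splits)
  next
    case False
    then have cpos: "c > 0" using c0 by simp
    \<comment> \<open>At \<open>\<lambda>t. - u t\<close> this is the normalized negative part of
      \<open>u\<close>.\<close>
    define M where "M v = density lborel (\<lambda>t. ennreal (max 0 (v t) / c))" for v :: "real \<Rightarrow> real"
    have M: "real_distribution (M v)" if v: "integrable lborel v" "(LINT t|lborel. max 0 (v t)) = c" for v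
    proof -
      have "emeasure (M v) (space (M v)) = (\<integral>\<^sup>+ t. ennreal (max 0 (v t) / c) \<partial>lborel)"
        using v(1) unfolding M_def by (subst emeasure_density) auto
      also have "\<dots> = ennreal (LINT t|lborel. max 0 (v t) / c)"
        using v(1) cpos by (intro nn_integral_eq_integral) auto
      also have "\<dots> = 1" using v(2) cpos by simp
      finally interpret prob_space "M v" by (intro prob_spaceI)
      show ?thesis by unfold_locales (auto simp: M_def)
    qed
    have charM: "char (M v) \<xi> = (LINT t|lborel. of_real (max 0 (v t)) * cis (\<xi> * t)) / c"
      if [measurable]: "v \<in> borel_measurable borel" for v \<xi>
    proof -
      have "char (M v) \<xi> = (LINT t|lborel. (max 0 (v t) / c) *\<^sub>R exp (\<i> * complex_of_real (\<xi> * t)))"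
        unfolding char_def M_def using cpos by (subst integral_density) auto
      also have "\<dots> = (LINT t|lborel. (of_real (max 0 (v t)) * cis (\<xi> * t)) / c)"
        by (intro Bochner_Integration.integral_cong) (auto simp: cis_conv_exp scaleR_conv_of_real)
      finally show ?thesis by simp
    qed
    have "M u = M (\<lambda>t. - u t)"
    proof (rule Levy_uniqueness)
      show "real_distribution (M u)" by (rule M) (use u c_def in auto)
      show "real_distribution (M (\<lambda>t. - u t))" by (rule M) (use u c2 in auto)
      show "char (M u) = char (M (\<lambda>t. - u t))" using eq by (auto simp: charM)
    qed
    then have "AE t in lborel. ennreal (max 0 (u t) / c) = ennreal (max 0 (- u t) / c)"
      unfolding M_def by (intro sigma_finite_measure.density_unique[OF sigma_finite_lborel]) auto
    then show ?thesis
      by eventually_elim (use cpos in \<open>auto simp: max_def field_simps split: if_splits\<close>)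
  qed
qed

text \<open>Conjugation reflects frequencies, so the transform of \<open>cnj k\<close> vanishes too,
  and with it those of the real and imaginary parts.\<close>

lemma integrable_char_zero:
  fixes k :: "real \<Rightarrow> complex"
  assumes k: "integrable lborel k"
    and zero: "\<And>\<xi>. (LINT t|lborel. k t * cis (\<xi> * t)) = 0"
  shows "AE t in lborel. k t = 0"
proof -
  have m[measurable]: "k \<in> borel_measurable borel" using k by simp
  have [measurable]: "(\<lambda>t. cnj (k t)) \<in> borel_measurable borel"
    by (rule measurable_compose[OF m]) (intro borel_measurable_continuous_onI continuous_intros)
  have int: "integrable lborel (\<lambda>t. k t * cis (\<xi> * t))" for \<xi>
    by (rule Bochner_Integration.integrable_bound[OF k]) (auto simp: norm_mult cis_conv_exp)
  have int2: "integrable lborel (\<lambda>t. cnj (k t) * cis (\<xi> * t))" for \<xi>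
    by (rule Bochner_Integration.integrable_bound[OF k]) (auto simp: norm_mult cis_conv_exp)
  have cnj0: "(LINT t|lborel. cnj (k t) * cis (\<xi> * t)) = 0" for \<xi>
  proof -
    have "(LINT t|lborel. cnj (k t) * cis (\<xi> * t)) = (LINT t|lborel. cnj (k t * cis (- \<xi> * t)))"
      by (intro Bochner_Integration.integral_cong) (auto simp: cis_cnj)
    also have "\<dots> = cnj (LINT t|lborel. k t * cis (- \<xi> * t))" 
      by (rule integral_bounded_linear[OF bounded_linear_cnj int])
    finally show ?thesis using zero[of "- \<xi>"] by simp
  qed
  have "AE t in lborel. Re (k t) = 0"
  proof (rule integrable_real_part_char_zero)
    fix \<xi>
    have "(LINT t|lborel. of_real (Re (k t)) * cis (\<xi> * t))
      = (LINT t|lborel. (k t * cis (\<xi> * t) + cnj (k t) * cis (\<xi> * t)) / 2)"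
      by (intro Bochner_Integration.integral_cong) (auto simp: complex_eq_iff)
    then show "(LINT t|lborel. of_real (Re (k t)) * cis (\<xi> * t)) = 0"
      using int int2 zero cnj0 by simp
  qed (use k in simp)
  moreover have "AE t in lborel. Im (k t) = 0"
  proof (rule integrable_real_part_char_zero)
    fix \<xi>
    have "(LINT t|lborel. of_real (Im (k t)) * cis (\<xi> * t))
      = (LINT t|lborel. (k t * cis (\<xi> * t) - cnj (k t) * cis (\<xi> * t)) / (2 * \<i>))"
      by (intro Bochner_Integration.integral_cong) (simp_all add: complex_diff_cnj complex_eq_iff flip: left_diff_distrib)
    then show "(LINT t|lborel. of_real (Im (k t)) * cis (\<xi> * t)) = 0"
      using int int2 zero cnj0 by simp
  qed (use k in simp)
  ultimately show ?thesis by eventually_elim (simp add: complex_eq_iff)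
qed

section \<open>Pairings of square integrable functions\<close>

lemma square_integrable_mult_integrable:
  fixes f g :: "'a \<Rightarrow> complex"
  assumes [measurable]: "f \<in> borel_measurable M" "g \<in> borel_measurable M"
    and "integrable M (\<lambda>x. (norm (f x))\<^sup>2)" "integrable M (\<lambda>x. (norm (g x))\<^sup>2)"
  shows "integrable M (\<lambda>x. f x * g x)"
proof (rule Bochner_Integration.integrable_bound)
  show "integrable M (\<lambda>x. (norm (f x))\<^sup>2 + (norm (g x))\<^sup>2)" using assms by simp
  have "a * b \<le> a\<^sup>2 + b\<^sup>2" if "a \<ge> 0" "b \<ge> 0" for a b :: real
    using sum_squares_bound[of a b] mult_nonneg_nonneg[OF that] by linarith
  then show "AE x in M. norm (f x * g x) \<le> norm ((norm (f x))\<^sup>2 + (norm (g x))\<^sup>2)"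
    by (auto simp: norm_mult)
qed simp

lemma norm_integral_mult_le:
  fixes f g :: "'a \<Rightarrow> complex"
  assumes f[measurable]: "f \<in> borel_measurable M" and g[measurable]: "g \<in> borel_measurable M"
    and f2: "integrable M (\<lambda>x. (norm (f x))\<^sup>2)" and g2: "integrable M (\<lambda>x. (norm (g x))\<^sup>2)"
  shows "(norm (LINT x|M. f x * g x))\<^sup>2 \<le> (LINT x|M. (norm (f x))\<^sup>2) * (LINT x|M. (norm (g x))\<^sup>2)"
proof -
  have fg: "integrable M (\<lambda>x. norm (f x * g x))"
    using square_integrable_mult_integrable[OF f g f2 g2] by simp
  have "ennreal ((LINT x|M. norm (f x * g x))\<^sup>2) = (\<integral>\<^sup>+x. ennreal (norm (f x)) * ennreal (norm (g x)) \<partial>M)\<^sup>2"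
    using fg by (subst ennreal_power[symmetric])
      (auto simp: nn_integral_eq_integral[symmetric] norm_mult ennreal_mult'
        intro!: Bochner_Integration.integral_nonneg)
  also have "\<dots> \<le> (\<integral>\<^sup>+x. ennreal (norm (f x)) ^ 2 \<partial>M) * (\<integral>\<^sup>+x. ennreal (norm (g x)) ^ 2 \<partial>M)"
    by (rule Cauchy_Schwarz_nn_integral) auto
  also have "\<dots> = ennreal ((LINT x|M. (norm (f x))\<^sup>2) * (LINT x|M. (norm (g x))\<^sup>2))"
    using f2 g2 by (subst ennreal_mult)
      (auto simp: nn_integral_eq_integral[symmetric] ennreal_power intro!: Bochner_Integration.integral_nonneg)
  finally have "(LINT x|M. norm (f x * g x))\<^sup>2 \<le> (LINT x|M. (norm (f x))\<^sup>2) * (LINT x|M. (norm (g x))\<^sup>2)"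
    by (subst (asm) ennreal_le_iff) (auto intro!: mult_nonneg_nonneg Bochner_Integration.integral_nonneg)
  moreover have "(norm (LINT x|M. f x * g x))\<^sup>2 \<le> (LINT x|M. norm (f x * g x))\<^sup>2"
    by (intro power_mono integral_norm_bound) auto
  ultimately show ?thesis by linarith
qed

section \<open>Square integral bounds for the transforms of intervals\<close>

lemma integrable_Cauchy_kernel:
  fixes \<delta> \<tau> :: real
  assumes "\<delta> > 0"
  shows "integrable lborel (\<lambda>t. 1 / (1 + \<delta>\<^sup>2 * (t + \<tau>)\<^sup>2))"
    and "(LINT t|lborel. 1 / (1 + \<delta>\<^sup>2 * (t + \<tau>)\<^sup>2)) = pi / \<delta>"
proof -
  have i: "integrable lborel (\<lambda>x::real. inverse (1 + x\<^sup>2))"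
    using integrable_inverse_1_plus_square by (simp add: set_integrable_def)
  have v: "(LINT x|lborel. inverse (1 + x\<^sup>2)) = pi"
    using LBINT_inverse_1_plus_square
    by (simp add: interval_lebesgue_integral_def set_lebesgue_integral_def)
  have eq: "inverse (1 + (\<delta> * \<tau> + \<delta> * t)\<^sup>2) = 1 / (1 + \<delta>\<^sup>2 * (t + \<tau>)\<^sup>2)" for t
  proof -
    have "\<delta> * \<tau> + \<delta> * t = \<delta> * (t + \<tau>)" by (simp add: algebra_simps)
    then show ?thesis by (simp add: power_mult_distrib inverse_eq_divide)
  qed
  show "integrable lborel (\<lambda>t. 1 / (1 + \<delta>\<^sup>2 * (t + \<tau>)\<^sup>2))"
    using lborel_integrable_real_affine[OF i, of \<delta> "\<delta> * \<tau>"] assms by (simp add: eq)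
  show "(LINT t|lborel. 1 / (1 + \<delta>\<^sup>2 * (t + \<tau>)\<^sup>2)) = pi / \<delta>"
    using lborel_integral_real_affine[of \<delta> "\<lambda>x. inverse (1 + x\<^sup>2)" "\<delta> * \<tau>"] v assms
    unfolding eq by (simp add: eq_divide_eq mult.commute)
qed


lemma norm_cis_diff_le: "cmod (cis y - cis x) \<le> \<bar>y - x\<bar>"
proof -
  have "cis y - cis x = cis x * (exp (\<i> * of_real (y - x)) - 1)"
    by (simp add: cis_conv_exp algebra_simps flip: exp_add)
  moreover have "cmod (exp (\<i> * of_real (y - x)) - 1) \<le> \<bar>y - x\<bar>"
    using iexp_approx1[of "y - x" 0] by simp
  ultimately show ?thesis by (simp add: norm_mult)
qed

lemma norm_cis_diff_le_2: "cmod (cis y - cis x) \<le> 2"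
  using norm_triangle_ineq4[of "cis y" "cis x"] by simp

text \<open>The integral of \<open>\<lambda>\<xi>. cis (\<xi> * t)\<close> from \<open>a\<close> to \<open>b\<close>, except for the junk value 0 at \<open>t = 0\<close>.\<close>

definition window :: "real \<Rightarrow> real \<Rightarrow> real \<Rightarrow> complex" where
  "window a b t = (cis (b * t) - cis (a * t)) / (\<i> * of_real t)"

lemma window_measurable[measurable]: "window a b \<in> borel_measurable borel"
  unfolding window_def cis_conv_exp by measurable

lemma window_add: "window a b t + window b c t = window a c t"
  by (simp add: window_def flip: add_divide_distrib)

lemma norm_window_le: "cmod (window a b t) \<le> \<bar>b - a\<bar>"
proof (cases "t = 0")
  case False
  have "cmod (cis (b * t) - cis (a * t)) \<le> \<bar>b - a\<bar> * \<bar>t\<bar>"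
    using norm_cis_diff_le[of "b * t" "a * t"] by (simp flip: abs_mult left_diff_distrib)
  then show ?thesis using False by (simp add: window_def norm_divide norm_mult divide_le_eq)
qed (simp add: window_def)

lemma norm_window_times_le: "cmod (window a b t) * \<bar>t\<bar> \<le> 2"
  using norm_cis_diff_le_2[of "b * t" "a * t"]
  by (cases "t = 0") (auto simp: window_def norm_divide norm_mult)

text \<open>Boundedness by \<open>c\<close> is combined with decay of order
  \<open>1 / \<bar>x\<bar>\<close>: the squares of the two bounds add up to
  \<open>c\<^sup>2 + 4 * c\<^sup>2\<close>, whence the 5.\<close>

lemma square_le_Cauchy_kernel:
  fixes z \<delta> c x :: real
  assumes "z \<ge> 0" "\<delta> \<ge> 0" "z \<le> c" "\<delta> * (z * \<bar>x\<bar>) \<le> 2 * c"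
  shows "z\<^sup>2 \<le> 5 * c\<^sup>2 * (1 / (1 + \<delta>\<^sup>2 * x\<^sup>2))"
proof -
  have "z\<^sup>2 \<le> c\<^sup>2" using assms by (intro power_mono)
  moreover have "(\<delta> * (z * \<bar>x\<bar>))\<^sup>2 \<le> (2 * c)\<^sup>2" using assms by (intro power_mono) auto
  ultimately have "z\<^sup>2 * (1 + \<delta>\<^sup>2 * x\<^sup>2) \<le> 5 * c\<^sup>2"
    by (simp add: algebra_simps power_mult_distrib)
  moreover have "1 + \<delta>\<^sup>2 * x\<^sup>2 > 0" by (simp add: add_pos_nonneg)
  ultimately show ?thesis by (simp add: field_simps)
qed

text \<open>For \<open>u\<close> near \<open>a\<close> the factor \<open>cis (u * \<tau>)\<close> is
  close to \<open>cis (a * \<tau>)\<close>; \<open>R b\<close> is the integral of this discrepancy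
  times \<open>cis (u * t)\<close> from \<open>a\<close> to \<open>b\<close>. The first bound serves
  for small \<open>t + \<tau>\<close>, the second gives the decay that makes it square
  integrable.\<close>

lemma window_shift_le:
  fixes a b t \<tau> :: real
  assumes "t \<noteq> 0" "t + \<tau> \<noteq> 0"
  defines "R \<equiv> \<lambda>u. window a u (t + \<tau>) - cis (a * \<tau>) * window a u t"
  shows "cmod (R b) \<le> \<bar>b - a\<bar>\<^sup>2 * \<bar>\<tau>\<bar>"
    and "cmod (R b) * \<bar>t + \<tau>\<bar> \<le> 2 * (\<bar>b - a\<bar> * \<bar>\<tau>\<bar>)"
proof -
  let ?I = "closed_segment a b"
  have d: "(R has_vector_derivative (cis (u * (t + \<tau>)) - cis (a * \<tau>) * cis (u * t))) (at u within ?I)" for u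
  proof -
    have "((\<lambda>u. window a u s) has_vector_derivative cis (u * s)) (at u within ?I)" if "s \<noteq> 0" for s
    proof -
      have "((\<lambda>u. (cis (s * u) - cis (a * s)) / (\<i> * of_real s)) has_vector_derivative
          (\<i> * of_real s * cis (s * u) - 0) / (\<i> * of_real s)) (at u within ?I)"
        by (intro has_vector_derivative_divide has_vector_derivative_diff has_vector_derivative_cis
            has_vector_derivative_const)
      then show ?thesis using that by (simp add: window_def mult.commute)
    qed
    from this[OF assms(2)] this[OF assms(1)] show ?thesis
      unfolding R_def by (intro has_vector_derivative_diff has_vector_derivative_mult_right)
  qed
  have "norm (R b - R a) \<le> (\<bar>b - a\<bar> * \<bar>\<tau>\<bar>) * norm (b - a)"
  proof (rule differentiable_bound[of ?I])
    fix u assume u: "u \<in> ?I"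
    then have "\<bar>u - a\<bar> \<le> \<bar>b - a\<bar>"
      using segment_bound(1)[OF u] by simp
    moreover have "cmod (cis (u * (t + \<tau>)) - cis (a * \<tau>) * cis (u * t)) \<le> \<bar>u - a\<bar> * \<bar>\<tau>\<bar>"
      using norm_cis_diff_le[of "u * (t + \<tau>)" "a * \<tau> + u * t"]
      by (simp add: cis_mult algebra_simps flip: abs_mult)
    ultimately have le: "cmod (cis (u * (t + \<tau>)) - cis (a * \<tau>) * cis (u * t)) \<le> \<bar>b - a\<bar> * \<bar>\<tau>\<bar>"
      by (meson abs_ge_zero mult_right_mono order_trans)
    show "onorm (\<lambda>x. x *\<^sub>R (cis (u * (t + \<tau>)) - cis (a * \<tau>) * cis (u * t))) \<le> \<bar>b - a\<bar> * \<bar>\<tau>\<bar>"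
      by (rule onorm_le) (use le in \<open>simp add: mult.commute mult_left_mono\<close>)
  qed (use d in \<open>auto simp: has_vector_derivative_def\<close>)
  moreover have "R a = 0" by (simp add: R_def window_def)
  ultimately show "cmod (R b) \<le> \<bar>b - a\<bar>\<^sup>2 * \<bar>\<tau>\<bar>"
    by (simp add: power2_eq_square mult_ac)
  \<comment> \<open>Splitting \<open>t + \<tau>\<close> in the second term cancels
    \<open>cis (a * (t + \<tau>))\<close> and leaves two terms, each of size at most
    \<open>\<bar>b - a\<bar> * \<bar>\<tau>\<bar>\<close>.\<close>
  have eq: "R b * of_real (t + \<tau>) = (cis (b * (t + \<tau>)) - cis (a * \<tau> + b * t)) / \<i>
      - cis (a * \<tau>) * window a b t * of_real \<tau>"
  proof -
    have w: "window a b s * of_real s = (cis (b * s) - cis (a * s)) / \<i>" if "s \<noteq> 0" for s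
      using that by (simp add: window_def)
    have "R b * of_real (t + \<tau>) = window a b (t + \<tau>) * of_real (t + \<tau>)
        - cis (a * \<tau>) * (window a b t * of_real t) - cis (a * \<tau>) * window a b t * of_real \<tau>"
      unfolding R_def by (simp add: algebra_simps)
    also have "cis (a * \<tau>) * (window a b t * of_real t) = (cis (a * \<tau> + b * t) - cis (a * (t + \<tau>))) / \<i>"
      unfolding w[OF assms(1)]
      by (simp only: times_divide_eq_right right_diff_distrib cis_mult distrib_left add.commute)
    also have "window a b (t + \<tau>) * of_real (t + \<tau>) - (cis (a * \<tau> + b * t) - cis (a * (t + \<tau>))) / \<i>
        - cis (a * \<tau>) * window a b t * of_real \<tau> = (cis (b * (t + \<tau>)) - cis (a * (t + \<tau>))) / \<i>
        - (cis (a * \<tau> + b * t) - cis (a * (t + \<tau>))) / \<i> - cis (a * \<tau>) * window a b t * of_real \<tau>"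
      unfolding w[OF assms(2)] ..
    finally show ?thesis by (simp add: algebra_simps)
  qed
  have "cmod (R b) * \<bar>t + \<tau>\<bar> = cmod (R b * of_real (t + \<tau>))"
    by (simp add: norm_mult del: of_real_add)
  also have "\<dots> \<le> cmod ((cis (b * (t + \<tau>)) - cis (a * \<tau> + b * t)) / \<i>)
      + cmod (cis (a * \<tau>) * window a b t * of_real \<tau>)"
    unfolding eq by (rule norm_triangle_ineq4)
  also have "\<dots> \<le> \<bar>b - a\<bar> * \<bar>\<tau>\<bar> + \<bar>b - a\<bar> * \<bar>\<tau>\<bar>"
  proof (rule add_mono)
    show "cmod ((cis (b * (t + \<tau>)) - cis (a * \<tau> + b * t)) / \<i>) \<le> \<bar>b - a\<bar> * \<bar>\<tau>\<bar>"
      using norm_cis_diff_le[of "b * (t + \<tau>)" "a * \<tau> + b * t"]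
      unfolding norm_divide by (simp add: algebra_simps flip: abs_mult)
    show "cmod (cis (a * \<tau>) * window a b t * of_real \<tau>) \<le> \<bar>b - a\<bar> * \<bar>\<tau>\<bar>"
      using norm_window_le[of a b t] by (simp add: norm_mult mult_right_mono)
  qed
  finally show "cmod (R b) * \<bar>t + \<tau>\<bar> \<le> 2 * (\<bar>b - a\<bar> * \<bar>\<tau>\<bar>)" by (simp add: mult.commute)
qed

lemma integrable_of_Cauchy_kernel_bound:
  fixes f :: "real \<Rightarrow> complex"
  assumes [measurable]: "f \<in> borel_measurable borel" and "\<delta> > 0"
    and bound: "AE t in lborel. (cmod (f t))\<^sup>2 \<le> B * (1 / (1 + \<delta>\<^sup>2 * (t + \<tau>)\<^sup>2))"
  shows "integrable lborel (\<lambda>t. (cmod (f t))\<^sup>2)"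
    and "(LINT t|lborel. (cmod (f t))\<^sup>2) \<le> B * pi / \<delta>"
proof -
  note k = integrable_Cauchy_kernel[OF assms(2), of \<tau>]
  have kB: "integrable lborel (\<lambda>t. B * (1 / (1 + \<delta>\<^sup>2 * (t + \<tau>)\<^sup>2)))"
    by (intro integrable_mult_right k)
  show i: "integrable lborel (\<lambda>t. (cmod (f t))\<^sup>2)"
    by (rule Bochner_Integration.integrable_bound[OF kB]) (use bound in \<open>auto elim!: eventually_mono intro: order_trans[OF _ abs_ge_self] simp del: abs_mult abs_divide\<close>)
  have "(LINT t|lborel. (cmod (f t))\<^sup>2) \<le> (LINT t|lborel. B * (1 / (1 + \<delta>\<^sup>2 * (t + \<tau>)\<^sup>2)))"
    by (rule integral_mono_AE[OF i kB bound])
  also have "\<dots> = B * pi / \<delta>" unfolding integral_mult_right_zero k(2) by simp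
  finally show "(LINT t|lborel. (cmod (f t))\<^sup>2) \<le> B * pi / \<delta>" .
qed

text \<open>The height \<open>\<bar>b - a\<bar>\<close> and the decay
  \<open>2 / \<bar>t\<bar>\<close> balance at a width of order \<open>1 / \<bar>b - a\<bar>\<close>,
  which is why the kernel is scaled by \<open>\<bar>b - a\<bar>\<close>. The exact value of the
  integral is \<open>2 * pi * \<bar>b - a\<bar>\<close>; only the linear order in the length
  matters.\<close>

lemma window_square_integrable:
  "integrable lborel (\<lambda>t. (cmod (window a b (t + \<tau>)))\<^sup>2)"
  "(LINT t|lborel. (cmod (window a b t))\<^sup>2) \<le> 5 * pi * \<bar>b - a\<bar>"
proof -
  have *: "integrable lborel (\<lambda>t. (cmod (window a b (t + \<tau>)))\<^sup>2) \<and>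
      (LINT t|lborel. (cmod (window a b (t + \<tau>)))\<^sup>2) \<le> 5 * pi * \<bar>b - a\<bar>" for \<tau>
  proof (cases "a = b")
    case False
    define \<delta> where "\<delta> = \<bar>b - a\<bar>"
    have \<delta>: "\<delta> > 0" using False by (simp add: \<delta>_def)
    have bound: "(cmod (window a b (t + \<tau>)))\<^sup>2 \<le> 5 * \<delta>\<^sup>2 * (1 / (1 + \<delta>\<^sup>2 * (t + \<tau>)\<^sup>2))" for t
      using norm_window_le[of a b "t + \<tau>"] norm_window_times_le[of a b "t + \<tau>"] \<delta>
        mult_left_mono[OF norm_window_times_le[of a b "t + \<tau>"], of \<delta>]
      by (intro square_le_Cauchy_kernel) (auto simp: \<delta>_def)
    have "(\<lambda>t. window a b (t + \<tau>)) \<in> borel_measurable borel" by measurable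
    from integrable_of_Cauchy_kernel_bound[OF this \<delta> AE_I2[OF bound]]
    moreover have "5 * \<delta>\<^sup>2 * pi / \<delta> = 5 * pi * \<delta>" using \<delta> by (simp add: power2_eq_square)
    ultimately show ?thesis by (simp add: \<delta>_def)
  qed (simp add: window_def)
  show "integrable lborel (\<lambda>t. (cmod (window a b (t + \<tau>)))\<^sup>2)" using * by blast
  show "(LINT t|lborel. (cmod (window a b t))\<^sup>2) \<le> 5 * pi * \<bar>b - a\<bar>" using *[of 0] by simp
qed

text \<open>The subtraction gains a factor of order \<open>\<bar>b - a\<bar>\<close> over a single
  window, hence the third power instead of the first. The square root then has order 3/2, above 1,
  which makes the derivative of the integrated transform vanish.\<close>

lemma window_shift_square_integrable:
  fixes a b \<tau> :: real
  defines "R \<equiv> \<lambda>t. window a b (t + \<tau>) - cis (a * \<tau>) * window a b t"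
  shows "R \<in> borel_measurable borel"
    and "integrable lborel (\<lambda>t. (cmod (R t))\<^sup>2)"
    and "(LINT t|lborel. (cmod (R t))\<^sup>2) \<le> 5 * pi * \<tau>\<^sup>2 * \<bar>b - a\<bar> ^ 3"
proof -
  show m: "R \<in> borel_measurable borel" unfolding R_def by measurable
  have "integrable lborel (\<lambda>t. (cmod (R t))\<^sup>2) \<and>
      (LINT t|lborel. (cmod (R t))\<^sup>2) \<le> 5 * pi * \<tau>\<^sup>2 * \<bar>b - a\<bar> ^ 3"
  proof (cases "a = b")
    case False
    define \<delta> where "\<delta> = \<bar>b - a\<bar>"
    have \<delta>: "\<delta> > 0" using False by (simp add: \<delta>_def)
    have "AE t in lborel. t \<noteq> (0::real)" "AE t in lborel. t \<noteq> - \<tau>" by (rule AE_lborel_singleton)+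
    then have bound: "AE t in lborel. (cmod (R t))\<^sup>2 \<le> 5 * (\<delta>\<^sup>2 * \<bar>\<tau>\<bar>)\<^sup>2 * (1 / (1 + \<delta>\<^sup>2 * (t + \<tau>)\<^sup>2))"
    proof eventually_elim
      case (elim t)
      then have t: "t \<noteq> 0" "t + \<tau> \<noteq> 0" by auto
      have "\<delta> * (cmod (R t) * \<bar>t + \<tau>\<bar>) \<le> \<delta> * (2 * (\<delta> * \<bar>\<tau>\<bar>))"
        using window_shift_le(2)[OF t] \<delta> by (intro mult_left_mono) (auto simp: R_def \<delta>_def)
      then show ?case
        using window_shift_le(1)[OF t, of a b] \<delta>
        by (intro square_le_Cauchy_kernel) (simp_all add: R_def \<delta>_def power2_eq_square mult_ac)
    qed
    have "5 * (\<delta>\<^sup>2 * \<bar>\<tau>\<bar>)\<^sup>2 * pi / \<delta> = 5 * pi * \<tau>\<^sup>2 * \<delta> ^ 3"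
      using \<delta> by (simp add: power_mult_distrib power2_eq_square power3_eq_cube)
    then show ?thesis using integrable_of_Cauchy_kernel_bound[OF m \<delta> bound] by (simp add: \<delta>_def)
  qed (simp add: R_def window_def)
  then show "integrable lborel (\<lambda>t. (cmod (R t))\<^sup>2)"
    "(LINT t|lborel. (cmod (R t))\<^sup>2) \<le> 5 * pi * \<tau>\<^sup>2 * \<bar>b - a\<bar> ^ 3" by auto
qed

section \<open>Injectivity of translation and dilation operators\<close>

lemma has_vector_derivative_zeroI:
  fixes H :: "real \<Rightarrow> 'a::real_normed_vector"
  assumes "\<And>y. norm (H y - H a) \<le> C * \<bar>y - a\<bar> * sqrt \<bar>y - a\<bar>"
  shows "(H has_vector_derivative 0) (at a)"
  unfolding has_vector_derivative_def has_derivative_iff_norm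
proof (intro conjI)
  have "((\<lambda>y. C * sqrt \<bar>y - a\<bar>) \<longlongrightarrow> C * sqrt \<bar>a - a\<bar>) (at a)"
    by (intro tendsto_intros)
  then have lim: "((\<lambda>y. C * sqrt \<bar>y - a\<bar>) \<longlongrightarrow> 0) (at a)" by simp
  show "((\<lambda>y. norm (H y - H a - (y - a) *\<^sub>R 0) / norm (y - a)) \<longlongrightarrow> 0) (at a)"
  proof (rule Lim_null_comparison[OF _ lim])
    have "norm (norm (H y - H a - (y - a) *\<^sub>R 0) / norm (y - a)) \<le> C * sqrt \<bar>y - a\<bar>" if "y \<noteq> a" for y
      using assms[of y] that by (simp add: divide_le_eq mult_ac)
    then show "\<forall>\<^sub>F y in at a. norm (norm (H y - H a - (y - a) *\<^sub>R 0) / norm (y - a)) \<le> C * sqrt \<bar>y - a\<bar>"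
      by (simp add: eventually_at_filter)
  qed
qed (auto intro: bounded_linear_intros)

text \<open>
  The integrated Fourier transform \<open>H\<close> of \<open>h\<close> is continuous, and multiplication by the trigonometric
  polynomial \<open>D\<close> kills its increments to first order. So \<open>H\<close> has derivative zero off the discrete
  zero set of \<open>D\<close>, hence is constant.
\<close>

lemma translation_comb_zero_imp_zero:
  fixes h :: "real \<Rightarrow> complex" and d :: "real \<Rightarrow> complex"
  assumes h[measurable]: "h \<in> borel_measurable borel"
    and h2: "integrable lborel (\<lambda>t. (cmod (h t))\<^sup>2)"
    and T: "finite T" "\<sigma> \<in> T" "d \<sigma> \<noteq> 0"
    and rel: "AE t in lborel. (\<Sum>\<tau>\<in>T. d \<tau> * h (t - \<tau>)) = 0"
  shows "AE t in lborel. h t = 0"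
proof -
  define N where "N = (LINT t|lborel. (cmod (h t))\<^sup>2)"
  have N: "N \<ge> 0" by (simp add: N_def)
  have int: "integrable lborel (\<lambda>t. h t * window a b (t + \<tau>))" for a b \<tau>
    by (intro square_integrable_mult_integrable h2 window_square_integrable) auto
  have int0: "integrable lborel (\<lambda>t. h t * window a b t)" for a b
    using int[of a b 0] by simp
  define H where "H \<xi> = (LINT t|lborel. h t * window 0 \<xi> t)" for \<xi>
  define D where "D \<xi> = (\<Sum>\<tau>\<in>T. d \<tau> * cis (\<tau> * \<xi>))" for \<xi>
  have Hdiff: "H b - H a = (LINT t|lborel. h t * window a b t)" for a b
  proof -
    have "H a + (LINT t|lborel. h t * window a b t) = (LINT t|lborel. h t * window 0 a t + h t * window a b t)"
      unfolding H_def by (intro Bochner_Integration.integral_add[symmetric] int0)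
    also have "\<dots> = H b" unfolding H_def by (simp add: window_add flip: distrib_left)
    finally show ?thesis by (simp add: algebra_simps)
  qed
  \<comment> \<open>The translations are moved from the windows onto \<open>h\<close>, where the
    assumed relation applies.\<close>
  have rel0: "(\<Sum>\<tau>\<in>T. d \<tau> * (LINT t|lborel. h t * window a b (t + \<tau>))) = 0" for a b
  proof -
    have shift: "(LINT t|lborel. h t * window a b (t + \<tau>)) = (LINT t|lborel. h (t - \<tau>) * window a b t)" for \<tau>
      using lborel_integral_real_affine[of 1 "\<lambda>t. h (t - \<tau>) * window a b t" \<tau>] by (simp add: add.commute)
    have ints: "integrable lborel (\<lambda>t. h (t - \<tau>) * window a b t)" for \<tau>
      using lborel_integrable_real_affine[OF int[of a b \<tau>], of 1 "-\<tau>"] by simp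
    have "(\<Sum>\<tau>\<in>T. d \<tau> * (LINT t|lborel. h t * window a b (t + \<tau>)))
        = (LINT t|lborel. (\<Sum>\<tau>\<in>T. d \<tau> * (h (t - \<tau>) * window a b t)))"
      unfolding shift by (subst Bochner_Integration.integral_sum) (auto intro!: ints)
    also have "\<dots> = 0"
      by (rule integral_eq_zero_AE) (use rel in eventually_elim, simp flip: mult.assoc sum_distrib_right)
    finally show ?thesis .
  qed
  have pair: "cmod (LINT t|lborel. h t * g t) \<le> sqrt (N * B)"
    if "g \<in> borel_measurable borel" "integrable lborel (\<lambda>t. (cmod (g t))\<^sup>2)"
      "(LINT t|lborel. (cmod (g t))\<^sup>2) \<le> B" for g B
  proof -
    have "(cmod (LINT t|lborel. h t * g t))\<^sup>2 \<le> N * (LINT t|lborel. (cmod (g t))\<^sup>2)"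
      unfolding N_def using that by (intro norm_integral_mult_le h2) auto
    also have "\<dots> \<le> N * B" using that N by (intro mult_left_mono)
    finally show ?thesis by (rule real_le_rsqrt)
  qed
  have cont: "continuous_on S H" for S
  proof -
    have "H \<midarrow>a\<rightarrow> H a" for a
    proof -
      have "((\<lambda>b. sqrt (N * (5 * pi * \<bar>b - a\<bar>))) \<longlongrightarrow> sqrt (N * (5 * pi * \<bar>a - a\<bar>))) (at a)"
        by (intro tendsto_intros)
      then have "((\<lambda>b. sqrt (N * (5 * pi * \<bar>b - a\<bar>))) \<longlongrightarrow> 0) (at a)" by simp
      moreover have "norm (H b - H a) \<le> sqrt (N * (5 * pi * \<bar>b - a\<bar>))" for b
        unfolding Hdiff using window_square_integrable(1)[of a b 0] window_square_integrable(2)[of a b]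
        by (intro pair) auto
      ultimately have "((\<lambda>b. H b - H a) \<longlongrightarrow> 0) (at a)"
        by (intro Lim_null_comparison[of "\<lambda>b. H b - H a"]) (auto intro: always_eventually)
      then show ?thesis by (simp add: LIM_zero_iff)
    qed
    then show ?thesis by (simp add: continuous_on_eq_continuous_at isCont_def continuous_at_imp_continuous_on)
  qed
  have deriv: "(H has_vector_derivative 0) (at a)" if Da: "D a \<noteq> 0" for a
  proof (rule has_vector_derivative_zeroI)
    fix b
    define R where "R \<tau> t = window a b (t + \<tau>) - cis (a * \<tau>) * window a b t" for \<tau> t
    note R = window_shift_square_integrable[where a = a and b = b, folded R_def]
    define \<delta> where "\<delta> = \<bar>b - a\<bar>"
    have intR: "integrable lborel (\<lambda>t. h t * R \<tau> t)" for \<tau>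
      by (intro square_integrable_mult_integrable h2 R(2)) (auto intro: R(1))
    \<comment> \<open>To first order a shifted window is the phase \<open>cis (a * \<tau>)\<close>
      times the window itself; weighted by \<open>d\<close> and summed over \<open>T\<close>, these
      phases form \<open>D a\<close>.\<close>
    have "(LINT t|lborel. h t * window a b (t + \<tau>))
        = cis (a * \<tau>) * (H b - H a) + (LINT t|lborel. h t * R \<tau> t)" for \<tau>
    proof -
      have "(LINT t|lborel. h t * window a b (t + \<tau>))
          = (LINT t|lborel. cis (a * \<tau>) * (h t * window a b t) + h t * R \<tau> t)"
        by (intro Bochner_Integration.integral_cong) (auto simp: R_def algebra_simps)
      also have "\<dots> = (LINT t|lborel. cis (a * \<tau>) * (h t * window a b t)) + (LINT t|lborel. h t * R \<tau> t)"
        by (intro Bochner_Integration.integral_add integrable_mult_right int0 intR)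
      finally show ?thesis by (simp add: Hdiff)
    qed
    then have "(\<Sum>\<tau>\<in>T. d \<tau> * (cis (a * \<tau>) * (H b - H a) + (LINT t|lborel. h t * R \<tau> t))) = 0"
      using rel0[of a b] by simp
    then have "D a * (H b - H a) = - (\<Sum>\<tau>\<in>T. d \<tau> * (LINT t|lborel. h t * R \<tau> t))"
      by (simp add: D_def distrib_left sum.distrib sum_distrib_right add_eq_0_iff2 mult.assoc mult.commute[of a])
    then have "cmod (D a) * cmod (H b - H a) = cmod (\<Sum>\<tau>\<in>T. d \<tau> * (LINT t|lborel. h t * R \<tau> t))"
      by (metis norm_minus_cancel norm_mult)
    also have "\<dots> \<le> (\<Sum>\<tau>\<in>T. cmod (d \<tau>) * cmod (LINT t|lborel. h t * R \<tau> t))"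
      by (rule order_trans[OF norm_sum]) (simp add: norm_mult)
    also have "\<dots> \<le> (\<Sum>\<tau>\<in>T. cmod (d \<tau>) * (sqrt (N * (5 * pi * \<tau>\<^sup>2)) * (\<delta> * sqrt \<delta>)))"
    proof (intro sum_mono mult_left_mono)
      fix \<tau>
      have "cmod (LINT t|lborel. h t * R \<tau> t) \<le> sqrt (N * (5 * pi * \<tau>\<^sup>2 * \<delta> ^ 3))"
        by (rule pair) (use R[of \<tau>] in \<open>auto simp: \<delta>_def\<close>)
      also have "sqrt (N * (5 * pi * \<tau>\<^sup>2 * \<delta> ^ 3)) = sqrt (N * (5 * pi * \<tau>\<^sup>2)) * (\<delta> * sqrt \<delta>)"
        by (simp add: power3_eq_cube real_sqrt_mult \<delta>_def)
      finally show "cmod (LINT t|lborel. h t * R \<tau> t) \<le> sqrt (N * (5 * pi * \<tau>\<^sup>2)) * (\<delta> * sqrt \<delta>)" .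
    qed auto
    finally have "cmod (D a) * cmod (H b - H a)
        \<le> (\<Sum>\<tau>\<in>T. cmod (d \<tau>) * sqrt (N * (5 * pi * \<tau>\<^sup>2))) * (\<delta> * sqrt \<delta>)"
      by (simp add: sum_distrib_right mult.assoc)
    then show "norm (H b - H a)
        \<le> ((\<Sum>\<tau>\<in>T. cmod (d \<tau>) * sqrt (N * (5 * pi * \<tau>\<^sup>2))) / cmod (D a)) * \<bar>b - a\<bar> * sqrt \<bar>b - a\<bar>"
      using Da by (simp add: \<delta>_def field_simps)
  qed
  \<comment> \<open>The finitely many zeros of \<open>D\<close> in the interval are harmless for the
    fundamental theorem of calculus because \<open>H\<close> is continuous.\<close>
  have const: "H a = H b" if "a \<le> b" for a b
  proof -
    have "finite {x \<in> {a..b}. D x = 0}"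
      unfolding D_def by (rule trig_poly_finite_zeros[where d = d, OF T])
    then have "((\<lambda>_. 0) has_integral H b - H a) {a..b}"
      by (rule fundamental_theorem_of_calculus_strong[OF _ that]) (use deriv cont in auto)
    then have "H b - H a = 0" by (rule has_integral_unique) simp
    then show ?thesis by simp
  qed
  \<comment> \<open>\<open>h\<close> itself need not be integrable, but its product with a window
    is. Modulation by \<xi> moves the window to the interval from \<xi> to \<open>\<xi> + 1\<close>,
    so the transform of \<open>k\<close> is an increment of \<open>H\<close>.\<close>
  define k where "k t = h t * window 0 1 t" for t
  have "AE t in lborel. k t = 0"
  proof (rule integrable_char_zero)
    show "integrable lborel k" unfolding k_def by (rule int0)
    fix \<xi>
    have "window 0 1 t * cis (\<xi> * t) = window \<xi> (\<xi> + 1) t" for t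
    proof -
      have "cis ((\<xi> + 1) * t) = cis t * cis (\<xi> * t)" by (simp add: cis_mult distrib_right add.commute)
      then show ?thesis by (simp add: window_def left_diff_distrib)
    qed
    then have "(LINT t|lborel. k t * cis (\<xi> * t)) = (LINT t|lborel. h t * window \<xi> (\<xi> + 1) t)"
      by (simp add: k_def mult.assoc)
    also have "\<dots> = H (\<xi> + 1) - H \<xi>" by (rule Hdiff[symmetric])
    finally show "(LINT t|lborel. k t * cis (\<xi> * t)) = 0" using const[of \<xi> "\<xi> + 1"] by simp
  qed
  \<comment> \<open>The numerator \<open>cis t - 1\<close> of \<open>window 0 1 t\<close>, written
    as a trigonometric polynomial: it vanishes only on a null set, so \<open>h\<close> is zero
    wherever else \<open>k\<close> is.\<close>
  moreover have "AE t in lborel. (\<Sum>\<tau>\<in>{0,1::real}. (if \<tau> = 0 then -1 else 1) * cis (\<tau> * t)) \<noteq> 0"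
    by (rule AE_lborel_trig_poly_nonzero[of _ 0]) auto
  moreover have "AE t in lborel. t \<noteq> (0::real)" by (rule AE_lborel_singleton)
  ultimately show ?thesis
    by eventually_elim (auto simp: k_def window_def)
qed

section \<open>From the multiplicative half line to the additive line\<close>

lemma AE_lborel_exp:
  assumes "AE x in lborel. x > 0 \<longrightarrow> P x"
  shows "AE t::real in lborel. P (exp t)"
proof -
  obtain N where N: "N \<in> null_sets lborel" "{x. \<not> (x > 0 \<longrightarrow> P x)} \<subseteq> N"
    using assms unfolding eventually_ae_filter by auto
  \<comment> \<open>Differentiable maps send null sets to null sets, and \<open>ln\<close> is
    differentiable on the positive half line.\<close>
  have "negligible (N \<inter> {0<..})"
    using N(1) by (auto simp: negligible_iff_null_sets intro!: null_sets_completionI null_set_Int2)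
  then have "negligible (ln ` (N \<inter> {0<..}))"
  proof (rule negligible_differentiable_image_negligible[rotated])
    have "(ln has_real_derivative inverse x) (at x within S)" if "x > 0" for x :: real and S
      using that by (auto intro!: derivative_eq_intros simp: inverse_eq_divide)
    then show "ln differentiable_on N \<inter> {0<..}"
      by (fastforce simp: differentiable_on_def differentiable_def has_field_derivative_def)
  qed simp
  then have null: "ln ` (N \<inter> {0<..}) \<in> null_sets lebesgue" by (simp add: negligible_iff_null_sets)
  have "AE t in lebesgue. P (exp t)"
  proof (rule AE_I'[OF null])
    show "{t \<in> space lebesgue. \<not> P (exp t)} \<subseteq> ln ` (N \<inter> {0<..})"
    proof
      fix t assume "t \<in> {t \<in> space lebesgue. \<not> P (exp t)}"
      then have "exp t \<in> N \<inter> {0<..}" using N(2) by auto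
      then have "ln (exp t) \<in> ln ` (N \<inter> {0<..})" by (rule imageI)
      then show "t \<in> ln ` (N \<inter> {0<..})" by simp
    qed
  qed
  then show ?thesis by (simp add: AE_completion_iff)
qed

lemma AE_lborel_ln:
  assumes "AE t in lborel. P t"
  shows "AE x in lborel. x > 0 \<longrightarrow> P (ln x :: real)"
proof -
  obtain N where N: "N \<in> null_sets lborel" "{x. \<not> P x} \<subseteq> N"
    using assms unfolding eventually_ae_filter by auto
  have "negligible N"
    using N(1) by (auto simp: negligible_iff_null_sets intro!: null_sets_completionI)
  then have "negligible (exp ` N)"
  proof (rule negligible_differentiable_image_negligible[rotated])
    have "(exp has_real_derivative exp x) (at x within S)" for x :: real and S
      using DERIV_exp by (rule has_field_derivative_at_within)
    then show "exp differentiable_on N"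
      by (fastforce simp: differentiable_on_def differentiable_def has_field_derivative_def)
  qed simp
  then have null: "exp ` N \<in> null_sets lebesgue" by (simp add: negligible_iff_null_sets)
  have "AE x in lebesgue. x > 0 \<longrightarrow> P (ln x)"
  proof (rule AE_I'[OF null])
    show "{x \<in> space lebesgue. \<not> (x > 0 \<longrightarrow> P (ln x))} \<subseteq> exp ` N"
    proof
      fix x assume x: "x \<in> {x \<in> space lebesgue. \<not> (x > 0 \<longrightarrow> P (ln x))}"
      then have "ln x \<in> N" using N(2) by auto
      then have "exp (ln x) \<in> exp ` N" by (rule imageI)
      then show "x \<in> exp ` N" using x by simp
    qed
  qed
  then show ?thesis by (simp add: AE_completion_iff)
qed

text \<open>The substitution \<open>x = exp t\<close> turns dilations into translations, and the
  weight \<open>exp (t / 2)\<close>, the square root of the Jacobian, preserves square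
  integrability. This reduces the claim to \<open>translation_comb_zero_imp_zero\<close>.\<close>

lemma dilation_comb_zero_imp_zero:
  fixes f :: "real \<Rightarrow> complex"
  assumes f[measurable]: "f \<in> borel_measurable borel"
    and f2: "integrable lborel (\<lambda>x. (cmod (f x))\<^sup>2)"
    and L: "finite L" "L \<subseteq> {0<..}" "u \<in> L" "c u \<noteq> 0"
    and rel: "AE x in lborel. x > 0 \<longrightarrow> dilation_comb L c f x = 0"
  shows "AE x in lborel. x > 0 \<longrightarrow> f x = 0"
proof -
  define h where "h t = of_real (exp (t / 2)) * f (exp t)" for t :: real
  have [measurable]: "h \<in> borel_measurable borel" unfolding h_def by measurable
  have h2: "integrable lborel (\<lambda>t. (cmod (h t))\<^sup>2)"
  proof -
    have range_exp: "range exp = {0::real<..}"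
      using exp_ln by (auto simp: image_iff) (metis exp_ln)
    have "integrable lebesgue (\<lambda>x. (cmod (f x))\<^sup>2)"
      using f2 by (simp add: integrable_completion)
    then have "(\<lambda>x. (cmod (f x))\<^sup>2) absolutely_integrable_on UNIV"
      by (simp add: set_integrable_def)
    then have "(\<lambda>x. (cmod (f x))\<^sup>2) absolutely_integrable_on (exp ` UNIV)"
      by (rule set_integrable_subset) (auto simp: range_exp)
    then have "(\<lambda>t. \<bar>exp t\<bar> *\<^sub>R (cmod (f (exp t)))\<^sup>2) absolutely_integrable_on UNIV"
      by (subst absolutely_integrable_change_of_variables_real[symmetric])
         (auto intro!: derivative_eq_intros simp: inj_on_def)
    then have "integrable lebesgue (\<lambda>t. exp t * (cmod (f (exp t)))\<^sup>2)"
      by (simp add: set_integrable_def)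
    then have "integrable lborel (\<lambda>t. exp t * (cmod (f (exp t)))\<^sup>2)"
      by (subst (asm) integrable_completion) auto
    moreover have "(cmod (h t))\<^sup>2 = exp t * (cmod (f (exp t)))\<^sup>2" for t
      by (simp add: h_def norm_mult power_mult_distrib flip: exp_double)
    ultimately show ?thesis by simp
  qed
  have "AE t in lborel. h t = 0"
  proof (rule translation_comb_zero_imp_zero[where T = "ln ` L" and \<sigma> = "ln u"])
    \<comment> \<open>The factor \<open>exp (\<tau> / 2)\<close> compensates the weight
      \<open>exp ((t - \<tau>) / 2)\<close> in \<open>h (t - \<tau>)\<close>, so that
      \<open>exp (t / 2)\<close> becomes common to all terms.\<close>
    define d where "d \<tau> = c (exp \<tau>) * of_real (exp (\<tau> / 2))" for \<tau> :: real
    show "d (ln u) \<noteq> 0" using L by (auto simp: d_def)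
    have inj: "inj_on ln L" by (intro inj_onI) (metis L(2) greaterThan_iff ln_inj_iff subsetD)
    show "AE t in lborel. (\<Sum>\<tau>\<in>ln ` L. d \<tau> * h (t - \<tau>)) = 0"
      using AE_lborel_exp[OF rel]
    proof eventually_elim
      case (elim t)
      have "(\<Sum>\<tau>\<in>ln ` L. d \<tau> * h (t - \<tau>)) = (\<Sum>l\<in>L. d (ln l) * h (t - ln l))"
        using inj by (simp add: sum.reindex)
      also have "\<dots> = (\<Sum>l\<in>L. of_real (exp (t / 2)) * (c l * f (exp t / l)))"
      proof (rule sum.cong)
        fix l assume "l \<in> L"
        then have "l > 0" using L by auto
        have "exp (ln l / 2) * exp ((t - ln l) / 2) = exp (t / 2)"
          by (simp add: diff_divide_distrib flip: exp_add)
        then have e: "complex_of_real (exp (ln l / 2)) * of_real (exp ((t - ln l) / 2)) = of_real (exp (t / 2))"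
          by (simp flip: of_real_mult)
        have "exp (t - ln l) = exp t / l" using \<open>l > 0\<close> by (simp add: exp_diff)
        then have "d (ln l) * h (t - ln l)
          = (complex_of_real (exp (ln l / 2)) * of_real (exp ((t - ln l) / 2))) * (c l * f (exp t / l))"
          using \<open>l > 0\<close> by (simp add: d_def h_def mult_ac)
        then show "d (ln l) * h (t - ln l) = of_real (exp (t / 2)) * (c l * f (exp t / l))"
          unfolding e .
      qed simp
      also have "\<dots> = 0" using elim by (simp add: dilation_comb_def flip: sum_distrib_left)
      finally show ?case .
    qed
  qed (use L h2 in auto)
  from AE_lborel_ln[OF this] show ?thesis
    by eventually_elim (auto simp: h_def)
qed

section \<open>The Fourier transform of an affine relation\<close>

lemma borel_measurable_cis[measurable (raw)]:
  "f \<in> borel_measurable M \<Longrightarrow> (\<lambda>x. cis (f x)) \<in> borel_measurable M"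
  unfolding cis_conv_exp by measurable

section \<open>Borel representatives of Lebesgue measurable functions\<close>

lemma integrable_lborel_indicator_Icc: "integrable lborel (indicat_real {a..b :: real})"
  by (rule integrable_real_indicator) (auto simp: emeasure_lborel_Icc_eq)

lemma borel_imp_lebesgue_measurable: "f \<in> borel_measurable borel \<Longrightarrow> f \<in> borel_measurable lebesgue"
  by (rule measurable_completion) simp

text \<open>Needed because the notions of the theorem are over \<open>lebesgue\<close>, whereas
  affine substitutions and Fubini's theorem are applied over \<open>lborel\<close>.\<close>

lemma borel_representative:
  fixes f :: "real \<Rightarrow> complex"
  assumes f: "f \<in> borel_measurable lebesgue"
  obtains f' where "f' \<in> borel_measurable borel" "AE x in lborel. f x = f' x"
proof -
  have "(\<lambda>x. Re (f x)) \<in> borel_measurable lebesgue"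
    using f by (simp add: borel_measurable_complex_iff)
  then obtain u where u: "u \<in> borel_measurable lborel" "AE x in lborel. Re (f x) = u x"
    by (blast dest: completion_ex_borel_measurable_real)
  have "(\<lambda>x. Im (f x)) \<in> borel_measurable lebesgue"
    using f by (simp add: borel_measurable_complex_iff)
  then obtain v where v: "v \<in> borel_measurable lborel" "AE x in lborel. Im (f x) = v x"
    by (blast dest: completion_ex_borel_measurable_real)
  show thesis
  proof
    show "(\<lambda>x. Complex (u x) (v x)) \<in> borel_measurable borel"
      using u(1) v(1) by (simp add: borel_measurable_complex_iff)
    show "AE x in lborel. f x = Complex (u x) (v x)"
      using u(2) v(2) by eventually_elim (simp add: complex_eq_iff)
  qed
qed

lemma lebesgue_integral_representative:
  fixes f f' :: "real \<Rightarrow> 'a::{banach, second_countable_topology}"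
  assumes f: "f \<in> borel_measurable lebesgue" and f': "f' \<in> borel_measurable borel"
    and eq: "AE x in lborel. f x = f' x"
  shows "(LINT x|lebesgue. f x) = (LINT x|lborel. f' x)"
    and "integrable lebesgue f \<longleftrightarrow> integrable lborel f'"
proof -
  have f'l: "f' \<in> borel_measurable lebesgue" using f' by (intro measurable_completion) simp
  have eq': "AE x in lebesgue. f x = f' x" using eq by (simp add: AE_completion_iff)
  have "(LINT x|lebesgue. f x) = (LINT x|lebesgue. f' x)"
    by (rule Bochner_Integration.integral_cong_AE[OF f f'l eq'])
  then show "(LINT x|lebesgue. f x) = (LINT x|lborel. f' x)" using f' by (simp add: integral_completion)
  have "integrable lebesgue f \<longleftrightarrow> integrable lebesgue f'"
    by (rule Bochner_Integration.integrable_cong_AE[OF f f'l eq'])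
  then show "integrable lebesgue f \<longleftrightarrow> integrable lborel f'" using f' by (simp add: integrable_completion)
qed

text \<open>Strong convergence implies weak convergence, by Cauchy-Schwarz. It lets identities for
  integrable functions pass to the limit that defines the transform.\<close>

lemma L2_tendsto_integral_mult:
  assumes F: "L2_tendsto F f" and g: "square_integrable g"
  shows "(\<lambda>n. LINT x|lebesgue. F n x * g x) \<longlonglongrightarrow> (LINT x|lebesgue. f x * g x)"
proof -
  have m: "F n \<in> borel_measurable lebesgue" "f \<in> borel_measurable lebesgue" "g \<in> borel_measurable lebesgue"
    and i: "integrable lebesgue (\<lambda>x. (norm (F n x))\<^sup>2)" "integrable lebesgue (\<lambda>x. (norm (f x))\<^sup>2)"
      "integrable lebesgue (\<lambda>x. (norm (g x))\<^sup>2)" for n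
    using F g by (auto simp: L2_tendsto_def square_integrable_def)
  have md[measurable]: "(\<lambda>x. F n x - f x) \<in> borel_measurable lebesgue" for n using m by (intro borel_measurable_diff)
  have id: "integrable lebesgue (\<lambda>x. (norm (F n x - f x))\<^sup>2)" for n
  proof (rule Bochner_Integration.integrable_bound)
    show "integrable lebesgue (\<lambda>x. 2 * (norm (F n x))\<^sup>2 + 2 * (norm (f x))\<^sup>2)" using i by auto
    have "(norm (u - v))\<^sup>2 \<le> 2 * (norm u)\<^sup>2 + 2 * (norm v)\<^sup>2" for u v :: complex
    proof -
      have "(norm (u - v))\<^sup>2 \<le> (norm u + norm v)\<^sup>2" by (intro power_mono norm_triangle_ineq4) auto
      also have "\<dots> \<le> 2 * (norm u)\<^sup>2 + 2 * (norm v)\<^sup>2"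
        using zero_le_power2[of "norm u - norm v"] by (simp add: power2_eq_square algebra_simps)
      finally show ?thesis .
    qed
    then show "AE x in lebesgue. norm ((norm (F n x - f x))\<^sup>2) \<le> norm (2 * (norm (F n x))\<^sup>2 + 2 * (norm (f x))\<^sup>2)"
      by simp
  qed measurable
  define E where "E n = (LINT x|lebesgue. (norm (F n x - f x))\<^sup>2)" for n
  define G where "G = (LINT x|lebesgue. (norm (g x))\<^sup>2)"
  have "E \<longlonglongrightarrow> 0" using F unfolding L2_tendsto_def E_def[abs_def] by blast
  then have "(\<lambda>n. sqrt (E n * G)) \<longlonglongrightarrow> sqrt (0 * G)" by (intro tendsto_intros)
  then have lim: "(\<lambda>n. sqrt (E n * G)) \<longlonglongrightarrow> 0" by simp
  have bound: "norm ((LINT x|lebesgue. F n x * g x) - (LINT x|lebesgue. f x * g x)) \<le> sqrt (E n * G)" for n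
  proof -
    have "(LINT x|lebesgue. F n x * g x) - (LINT x|lebesgue. f x * g x)
        = (LINT x|lebesgue. F n x * g x - f x * g x)"
      by (intro Bochner_Integration.integral_diff[symmetric] square_integrable_mult_integrable m i)
    also have "\<dots> = (LINT x|lebesgue. (F n x - f x) * g x)" by (simp add: left_diff_distrib)
    finally show ?thesis
      using norm_integral_mult_le[OF md m(3) id i(3), of n] unfolding E_def G_def
      by (simp add: real_le_rsqrt)
  qed
  have "(\<lambda>n. (LINT x|lebesgue. F n x * g x) - (LINT x|lebesgue. f x * g x)) \<longlonglongrightarrow> 0"
    by (rule Lim_null_comparison[OF always_eventually lim]) (use bound in auto)
  then show ?thesis by (simp add: LIM_zero_iff)
qed

text \<open>The case \<open>t = 0\<close> is excluded because \<open>window\<close> takes the value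
  0 there instead of the length \<open>b - a\<close>.\<close>

lemma integral_cis_interval:
  assumes "a \<le> b" "t \<noteq> 0"
  shows "(LINT \<gamma>|lborel. indicator {a..b} \<gamma> * cis (t * \<gamma>)) = window a b t"
proof -
  have "(LINT \<gamma>|lborel. indicator {a..b} \<gamma> *\<^sub>R cis (t * \<gamma>)) = cis (t * b) / (\<i> * of_real t) - cis (t * a) / (\<i> * of_real t)"
  proof (rule integral_FTC_atLeastAtMost[OF assms(1)])
    fix x
    have "((\<lambda>x. cis (t * x) / (\<i> * of_real t)) has_vector_derivative
        (\<i> * of_real t * cis (t * x)) / (\<i> * of_real t)) (at x within {a..b})"
      by (intro has_vector_derivative_divide has_vector_derivative_cis)
    then show "((\<lambda>x. cis (t * x) / (\<i> * of_real t)) has_vector_derivative cis (t * x)) (at x within {a..b})"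
      using assms(2) by simp
  qed (auto simp: cis_conv_exp intro!: continuous_intros)
  moreover have "indicator {a..b} \<gamma> *\<^sub>R cis (t * \<gamma>) = indicator {a..b} \<gamma> * cis (t * \<gamma>)" for \<gamma>
    by (simp add: indicator_def)
  ultimately show ?thesis
    by (simp add: window_def diff_divide_distrib mult.commute[of _ t])
qed

text \<open>The multiplication formula, by Fubini: the interval is bounded and \<open>f\<close>
  integrable, so the double integral converges absolutely, and the integral over the interval is a
  window.\<close>

lemma fourier_windowed_integral:
  fixes f :: "real \<Rightarrow> complex"
  assumes [measurable]: "f \<in> borel_measurable borel" and f: "integrable lborel f" and "a \<le> b"
  shows "(LINT \<gamma>|lborel. (LINT x|lborel. f x * cis (- 2 * pi * x * \<gamma>)) * (indicator {a..b} \<gamma> * cis (\<omega> * \<gamma>)))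
    = (LINT x|lborel. f x * window a b (\<omega> - 2 * pi * x))"
proof -
  let ?g = "\<lambda>x \<gamma>. f x * (indicator {a..b} \<gamma> * cis ((\<omega> - 2 * pi * x) * \<gamma>))"
  have meas: "(\<lambda>(x, \<gamma>). ?g x \<gamma>) \<in> borel_measurable (lborel \<Otimes>\<^sub>M lborel)"
    by measurable
  have n: "norm (?g x \<gamma>) = norm (f x) * indicator {a..b} \<gamma>" for x \<gamma>
    by (simp add: norm_mult indicator_def)
  have int: "integrable (lborel \<Otimes>\<^sub>M lborel) (\<lambda>(x, \<gamma>). ?g x \<gamma>)"
  proof (rule lborel_pair.Fubini_integrable)
    show "integrable lborel (\<lambda>x. LINT \<gamma>|lborel. norm (case (x, \<gamma>) of (x, \<gamma>) \<Rightarrow> ?g x \<gamma>))"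
      using f by (simp add: n)
    have "integrable lborel (\<lambda>\<gamma>. ?g x \<gamma>)" for x
    proof (rule Bochner_Integration.integrable_bound)
      show "integrable lborel (\<lambda>\<gamma>. norm (f x) * indicator {a..b} \<gamma>)"
        by (intro integrable_mult_right integrable_lborel_indicator_Icc)
    qed (simp_all add: n)
    then show "AE x in lborel. integrable lborel (\<lambda>\<gamma>. case (x, \<gamma>) of (x, \<gamma>) \<Rightarrow> ?g x \<gamma>)" by simp
  qed (rule meas)
  have "(LINT \<gamma>|lborel. (LINT x|lborel. f x * cis (- 2 * pi * x * \<gamma>)) * (indicator {a..b} \<gamma> * cis (\<omega> * \<gamma>)))
      = (LINT \<gamma>|lborel. LINT x|lborel. ?g x \<gamma>)"
  proof (intro Bochner_Integration.integral_cong refl)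
    fix \<gamma>
    have c: "cis (- 2 * pi * x * \<gamma>) * cis (\<omega> * \<gamma>) = cis ((\<omega> - 2 * pi * x) * \<gamma>)" for x
      by (simp add: cis_mult algebra_simps)
    have "(LINT x|lborel. f x * cis (- 2 * pi * x * \<gamma>)) * (indicator {a..b} \<gamma> * cis (\<omega> * \<gamma>))
        = (LINT x|lborel. f x * cis (- 2 * pi * x * \<gamma>) * (indicator {a..b} \<gamma> * cis (\<omega> * \<gamma>)))"
      by (rule integral_mult_left_zero[symmetric])
    also have "\<dots> = (LINT x|lborel. ?g x \<gamma>)"
      unfolding c[symmetric] by (simp only: mult_ac)
    finally show "(LINT x|lborel. f x * cis (- 2 * pi * x * \<gamma>)) * (indicator {a..b} \<gamma> * cis (\<omega> * \<gamma>))
        = (LINT x|lborel. ?g x \<gamma>)" .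
  qed
  also have "\<dots> = (LINT x|lborel. LINT \<gamma>|lborel. ?g x \<gamma>)"
    by (rule lborel_pair.Fubini_integral[OF int])
  also have "\<dots> = (LINT x|lborel. f x * window a b (\<omega> - 2 * pi * x))"
  proof (rule Bochner_Integration.integral_cong_AE)
    \<comment> \<open>The only \<open>x\<close> at which the window has argument 0 and thus its
      default value.\<close>
    have "AE x in lborel. x \<noteq> \<omega> / (2 * pi)" by (rule AE_lborel_singleton)
    then show "AE x in lborel. (LINT \<gamma>|lborel. ?g x \<gamma>) = f x * window a b (\<omega> - 2 * pi * x)"
    proof eventually_elim
      case (elim x)
      then have "\<omega> - 2 * pi * x \<noteq> 0" by (auto simp: field_simps)
      then show ?case by (simp add: integral_cis_interval[OF assms(3)])
    qed
    show "(\<lambda>x. LINT \<gamma>|lborel. ?g x \<gamma>) \<in> borel_measurable lborel"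
      using meas by (intro lborel.borel_measurable_lebesgue_integral) auto
  qed measurable
  finally show ?thesis .
qed

lemma fourier_representative:
  assumes "integrable lebesgue f" "f' \<in> borel_measurable borel" "AE x in lborel. f x = f' x"
  shows "fourier f \<gamma> = (LINT x|lborel. f' x * cis (- 2 * pi * x * \<gamma>))"
proof -
  have e: "exp (- 2 * complex_of_real pi * \<i> * complex_of_real x * complex_of_real \<gamma>) = cis (- 2 * pi * x * \<gamma>)" for x
    by (simp add: cis_conv_exp mult_ac)
  have [measurable]: "(\<lambda>x. cis (- 2 * pi * x * \<gamma>)) \<in> borel_measurable borel" by measurable
  show ?thesis unfolding fourier_def e
  proof (rule lebesgue_integral_representative)
    show "(\<lambda>x. f x * cis (- 2 * pi * x * \<gamma>)) \<in> borel_measurable lebesgue"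
      by (rule borel_measurable_times[OF borel_measurable_integrable[OF assms(1)] borel_imp_lebesgue_measurable]) measurable
    show "AE x in lborel. f x * cis (- 2 * pi * x * \<gamma>) = f' x * cis (- 2 * pi * x * \<gamma>)"
      using assms(3) by eventually_elim simp
  qed (use assms in measurable)
qed

text \<open>The test functions on both sides are square integrable, so the formula for the
  integrable approximants passes to the limits \<phi> and \<psi>.\<close>

lemma L2_fourier_windowed_integral:
  fixes \<phi> \<psi> \<phi>' \<psi>' :: "real \<Rightarrow> complex"
  assumes F: "is_L2_fourier \<phi> \<psi>"
    and \<phi>'[measurable]: "\<phi>' \<in> borel_measurable borel" and \<phi>\<phi>': "AE x in lborel. \<phi> x = \<phi>' x"
    and \<psi>'[measurable]: "\<psi>' \<in> borel_measurable borel" and \<psi>\<psi>': "AE x in lborel. \<psi> x = \<psi>' x"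
    and ab: "a \<le> b"
  shows "(LINT \<gamma>|lborel. \<psi>' \<gamma> * (indicator {a..b} \<gamma> * cis (\<omega> * \<gamma>)))
    = (LINT x|lborel. \<phi>' x * window a b (\<omega> - 2 * pi * x))"
proof -
  obtain F where int: "\<And>n. integrable lebesgue (F n)" and F\<phi>: "L2_tendsto F \<phi>"
    and F\<psi>: "L2_tendsto (\<lambda>n. fourier (F n)) \<psi>"
    using F by (auto simp: is_L2_fourier_def)
  define p where "p \<gamma> = (indicator {a..b} \<gamma> * cis (\<omega> * \<gamma>) :: complex)" for \<gamma>
  define q where "q x = window a b (\<omega> - 2 * pi * x)" for x
  have p[measurable]: "p \<in> borel_measurable borel" unfolding p_def by measurable
  have q[measurable]: "q \<in> borel_measurable borel" unfolding q_def by measurable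
  have "integrable lborel (\<lambda>\<gamma>. (norm (p \<gamma>))\<^sup>2)"
  proof -
    have "(\<lambda>\<gamma>. (norm (p \<gamma>))\<^sup>2) = indicator {a..b}"
      by (auto simp: p_def norm_mult indicator_def)
    then show ?thesis by (simp add: integrable_lborel_indicator_Icc)
  qed
  then have p2: "square_integrable p"
    unfolding square_integrable_def by (auto simp: integrable_completion intro!: measurable_completion)
  have "integrable lborel (\<lambda>x. (norm (q x))\<^sup>2)"
    using lborel_integrable_real_affine[OF window_square_integrable(1)[of a b 0], of "- 2 * pi" \<omega>]
    by (simp add: q_def)
  then have q2: "square_integrable q"
    unfolding square_integrable_def by (auto simp: integrable_completion intro!: measurable_completion)
  have mF: "F n \<in> borel_measurable lebesgue" for n using int by auto
  have eq: "(LINT \<gamma>|lebesgue. fourier (F n) \<gamma> * p \<gamma>) = (LINT x|lebesgue. F n x * q x)" for n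
  proof -
    obtain f' where [measurable]: "f' \<in> borel_measurable borel" and f': "AE x in lborel. F n x = f' x"
      using borel_representative[OF mF] by blast
    have i': "integrable lborel f'"
      using int[of n] lebesgue_integral_representative(2)[OF mF _ f'] by simp
    have fm[measurable]: "fourier (F n) \<in> borel_measurable borel"
    proof -
      have "(\<lambda>\<gamma>. LINT x|lborel. f' x * cis (- 2 * pi * x * \<gamma>)) \<in> borel_measurable borel"
        by measurable
      then show ?thesis
        using fourier_representative[OF int _ f'] by (simp add: fun_eq_iff cong: measurable_cong)
    qed
    have "(LINT \<gamma>|lebesgue. fourier (F n) \<gamma> * p \<gamma>) = (LINT \<gamma>|lborel. fourier (F n) \<gamma> * p \<gamma>)"
      by (rule integral_completion) measurable
    also have "\<dots> = (LINT x|lborel. f' x * q x)"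
      unfolding p_def q_def fourier_representative[OF int \<open>f' \<in> _\<close> f']
      by (rule fourier_windowed_integral) (use i' ab in auto)
    also have "\<dots> = (LINT x|lebesgue. F n x * q x)"
    proof (rule lebesgue_integral_representative(1)[symmetric])
      show "(\<lambda>x. F n x * q x) \<in> borel_measurable lebesgue"
        by (rule borel_measurable_times[OF mF borel_imp_lebesgue_measurable[OF q]])
      show "AE x in lborel. F n x * q x = f' x * q x" using f' by eventually_elim simp
    qed measurable
    finally show ?thesis .
  qed
  have "(LINT \<gamma>|lebesgue. \<psi> \<gamma> * p \<gamma>) = (LINT x|lebesgue. \<phi> x * q x)"
    using L2_tendsto_integral_mult[OF F\<psi> p2] L2_tendsto_integral_mult[OF F\<phi> q2]
    unfolding eq by (rule LIMSEQ_unique)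
  moreover have "(LINT \<gamma>|lebesgue. \<psi> \<gamma> * p \<gamma>) = (LINT \<gamma>|lborel. \<psi>' \<gamma> * p \<gamma>)"
  proof (rule lebesgue_integral_representative(1))
    show "(\<lambda>x. \<psi> x * p x) \<in> borel_measurable lebesgue"
      using F\<psi> by (intro borel_measurable_times borel_imp_lebesgue_measurable[OF p])
        (auto simp: L2_tendsto_def square_integrable_def)
    show "AE x in lborel. \<psi> x * p x = \<psi>' x * p x" using \<psi>\<psi>' by eventually_elim simp
  qed measurable
  moreover have "(LINT x|lebesgue. \<phi> x * q x) = (LINT x|lborel. \<phi>' x * q x)"
  proof (rule lebesgue_integral_representative(1))
    show "(\<lambda>x. \<phi> x * q x) \<in> borel_measurable lebesgue"
      using F\<phi> by (intro borel_measurable_times borel_imp_lebesgue_measurable[OF q])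
        (auto simp: L2_tendsto_def square_integrable_def)
    show "AE x in lborel. \<phi> x * q x = \<phi>' x * q x" using \<phi>\<phi>' by eventually_elim simp
  qed measurable
  ultimately show ?thesis by (simp add: p_def q_def)
qed

text \<open>
  Testing against modulated indicators of intervals, whose transforms are the explicit functions
  \<^const>\<open>window\<close>, avoids Plancherel's theorem.
\<close>

lemma L2_fourier_affine_relation:
  fixes \<phi> \<psi> \<phi>' \<psi>' :: "real \<Rightarrow> complex" and c :: "'k \<Rightarrow> complex" and l \<beta> :: "'k \<Rightarrow> real"
  assumes F: "is_L2_fourier \<phi> \<psi>"
    and \<phi>'[measurable]: "\<phi>' \<in> borel_measurable borel" and \<phi>\<phi>': "AE x in lborel. \<phi> x = \<phi>' x"
    and \<psi>'[measurable]: "\<psi>' \<in> borel_measurable borel" and \<psi>\<psi>': "AE x in lborel. \<psi> x = \<psi>' x"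
    and \<phi>2: "integrable lborel (\<lambda>x. (cmod (\<phi>' x))\<^sup>2)" and \<psi>2: "integrable lborel (\<lambda>x. (cmod (\<psi>' x))\<^sup>2)"
    and A: "finite A" "\<And>k. k \<in> A \<Longrightarrow> l k > 0"
    and rel: "AE x in lborel. (\<Sum>k\<in>A. c k * \<phi>' (l k * x - \<beta> k)) = 0"
  shows "AE \<gamma> in lborel. (\<Sum>k\<in>A. c k / of_real (l k) * cis (- 2 * pi * \<beta> k / l k * \<gamma>) * \<psi>' (\<gamma> / l k)) = 0"
proof -
  define S where "S \<gamma> = (\<Sum>k\<in>A. c k / of_real (l k) * cis (- 2 * pi * \<beta> k / l k * \<gamma>) * \<psi>' (\<gamma> / l k))" for \<gamma>
  \<comment> \<open>Truncation makes the square integrable \<open>S\<close> integrable, as the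
    uniqueness of Fourier integrals requires.\<close>
  have zero: "AE \<gamma> in lborel. indicator {- real n..real n} \<gamma> * S \<gamma> = 0" for n
  proof (rule integrable_char_zero)
    define a b where "a = - real n" and "b = real n"
    have ab: "a \<le> b" by (simp add: a_def b_def)
    define P where "P \<xi> k \<gamma> = cis (- 2 * pi * \<beta> k / l k * \<gamma>) * \<psi>' (\<gamma> / l k) * (indicator {a..b} \<gamma> * cis (\<xi> * \<gamma>))"
      for \<xi> k \<gamma>
    have SP: "indicator {a..b} \<gamma> * S \<gamma> * cis (\<xi> * \<gamma>) = (\<Sum>k\<in>A. c k / of_real (l k) * P \<xi> k \<gamma>)" for \<xi> \<gamma>
      by (simp add: S_def P_def sum_distrib_left sum_distrib_right mult_ac)
    have Pint: "integrable lborel (P \<xi> k)" if k: "k \<in> A" for \<xi> k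
    proof -
      have "integrable lborel (\<lambda>\<gamma>. (cmod (\<psi>' (\<gamma> / l k)))\<^sup>2)"
        using lborel_integrable_real_affine[OF \<psi>2, of "inverse (l k)" 0] A(2)[OF k]
        by (simp add: divide_inverse mult.commute)
      moreover have "integrable lborel (\<lambda>\<gamma>. (cmod (cis (- 2 * pi * \<beta> k / l k * \<gamma>) * (indicator {a..b} \<gamma> * cis (\<xi> * \<gamma>))))\<^sup>2)"
      proof -
        have "(\<lambda>\<gamma>. (cmod (cis (- 2 * pi * \<beta> k / l k * \<gamma>) * (indicator {a..b} \<gamma> * cis (\<xi> * \<gamma>))))\<^sup>2) = indicator {a..b}"
          by (auto simp: norm_mult indicator_def)
        then show ?thesis by (simp add: integrable_lborel_indicator_Icc)
      qed
      ultimately have "integrable lborel (\<lambda>\<gamma>. \<psi>' (\<gamma> / l k) * (cis (- 2 * pi * \<beta> k / l k * \<gamma>) * (indicator {a..b} \<gamma> * cis (\<xi> * \<gamma>))))"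
        by (intro square_integrable_mult_integrable) auto
      then show ?thesis by (simp add: P_def[abs_def] mult_ac)
    qed
    \<comment> \<open>The substitutions \<open>\<gamma> = l k * u\<close> and
      \<open>x = l k * y - \<beta> k\<close> undo dilation and modulation. The window scales by
      \<open>1 / l k\<close>, which cancels the second Jacobian; the first remains.\<close>
    have Pval: "(LINT \<gamma>|lborel. P \<xi> k \<gamma>) = of_real (l k) * (LINT y|lborel. \<phi>' (l k * y - \<beta> k) * window a b (\<xi> - 2 * pi * y))"
      if k: "k \<in> A" for \<xi> k
    proof -
      have lk: "l k > 0" using A k by simp
      have ind: "indicator {a..b} (l k * u) = (indicator {a / l k..b / l k} u :: complex)" for u
        using lk by (auto simp: indicator_def field_simps)
      have "(LINT \<gamma>|lborel. P \<xi> k \<gamma>) = l k *\<^sub>R (LINT u|lborel. P \<xi> k (0 + l k * u))"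
        using lborel_integral_real_affine[of "l k" "P \<xi> k" 0] lk by simp
      also have "(LINT u|lborel. P \<xi> k (0 + l k * u))
        = (LINT u|lborel. \<psi>' u * (indicator {a / l k..b / l k} u * cis ((l k * \<xi> - 2 * pi * \<beta> k) * u)))"
      proof (intro Bochner_Integration.integral_cong refl)
        fix u
        have "P \<xi> k (0 + l k * u) = \<psi>' u * (indicator {a / l k..b / l k} u * (cis (- 2 * pi * \<beta> k * u) * cis (\<xi> * (l k * u))))"
          using ind[of u] lk by (simp add: P_def mult_ac)
        also have "cis (- 2 * pi * \<beta> k * u) * cis (\<xi> * (l k * u)) = cis ((l k * \<xi> - 2 * pi * \<beta> k) * u)"
          by (simp add: cis_mult algebra_simps)
        finally show "P \<xi> k (0 + l k * u)
          = \<psi>' u * (indicator {a / l k..b / l k} u * cis ((l k * \<xi> - 2 * pi * \<beta> k) * u))" .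
      qed
      also have "\<dots> = (LINT x|lborel. \<phi>' x * window (a / l k) (b / l k) (l k * \<xi> - 2 * pi * \<beta> k - 2 * pi * x))"
        using ab lk by (intro L2_fourier_windowed_integral[OF F \<phi>' \<phi>\<phi>' \<psi>' \<psi>\<psi>']) (simp add: divide_right_mono)
      also have "\<dots> = l k *\<^sub>R (LINT y|lborel. \<phi>' (- \<beta> k + l k * y) *
          window (a / l k) (b / l k) (l k * \<xi> - 2 * pi * \<beta> k - 2 * pi * (- \<beta> k + l k * y)))"
        using lborel_integral_real_affine[of "l k" "\<lambda>x. \<phi>' x * window (a / l k) (b / l k) (l k * \<xi> - 2 * pi * \<beta> k - 2 * pi * x)" "- \<beta> k"] lk
        by simp
      also have "\<dots> = (LINT y|lborel. \<phi>' (l k * y - \<beta> k) * window a b (\<xi> - 2 * pi * y))"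
      proof -
        have "\<phi>' (- \<beta> k + l k * y) * window (a / l k) (b / l k) (l k * \<xi> - 2 * pi * \<beta> k - 2 * pi * (- \<beta> k + l k * y))
            = \<phi>' (l k * y - \<beta> k) * window a b (\<xi> - 2 * pi * y) / of_real (l k)" for y
        proof -
          have "l k * \<xi> - 2 * pi * \<beta> k - 2 * pi * (- \<beta> k + l k * y) = l k * (\<xi> - 2 * pi * y)"
            by (simp add: algebra_simps)
          moreover have "window (a / l k) (b / l k) (l k * s) = window a b s / of_real (l k)" for s
            using lk by (simp add: window_def)
          ultimately show ?thesis by simp
        qed
        then show ?thesis using lk by (simp add: scaleR_conv_of_real)
      qed
      finally show ?thesis by (simp add: scaleR_conv_of_real)
    qed
    have "integrable lborel (\<lambda>\<gamma>. \<Sum>k\<in>A. c k / of_real (l k) * P 0 k \<gamma>)"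
      by (intro Bochner_Integration.integrable_sum integrable_mult_right Pint)
    then show "integrable lborel (\<lambda>\<gamma>. indicator {- real n..real n} \<gamma> * S \<gamma>)"
      unfolding SP[symmetric] by (simp add: a_def b_def)
    fix \<xi>
    have W: "integrable lborel (\<lambda>y. \<phi>' (l k * y - \<beta> k) * window a b (\<xi> - 2 * pi * y))" if k: "k \<in> A" for k
    proof (rule square_integrable_mult_integrable)
      show "integrable lborel (\<lambda>y. (cmod (\<phi>' (l k * y - \<beta> k)))\<^sup>2)"
        using lborel_integrable_real_affine[OF \<phi>2, of "l k" "- \<beta> k"] A(2)[OF k] by simp
      show "integrable lborel (\<lambda>y. (cmod (window a b (\<xi> - 2 * pi * y)))\<^sup>2)"
        using lborel_integrable_real_affine[OF window_square_integrable(1)[of a b 0], of "- 2 * pi" \<xi>] by simp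
    qed measurable
    have "(LINT \<gamma>|lborel. indicator {a..b} \<gamma> * S \<gamma> * cis (\<xi> * \<gamma>))
        = (\<Sum>k\<in>A. c k / of_real (l k) * (LINT \<gamma>|lborel. P \<xi> k \<gamma>))"
      unfolding SP by (subst Bochner_Integration.integral_sum) (auto intro!: Pint)
    also have "\<dots> = (\<Sum>k\<in>A. c k * (LINT y|lborel. \<phi>' (l k * y - \<beta> k) * window a b (\<xi> - 2 * pi * y)))"
    proof (rule sum.cong)
      fix k assume "k \<in> A"
      then show "c k / of_real (l k) * (LINT \<gamma>|lborel. P \<xi> k \<gamma>)
          = c k * (LINT y|lborel. \<phi>' (l k * y - \<beta> k) * window a b (\<xi> - 2 * pi * y))"
        using A(2)[of k] Pval[of k \<xi>] by simp
    qed simp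
    \<comment> \<open>The window is now the same for every \<open>k\<close>, so it factors out of
      the sum and the assumed relation applies.\<close>
    also have "\<dots> = (LINT y|lborel. (\<Sum>k\<in>A. c k * (\<phi>' (l k * y - \<beta> k) * window a b (\<xi> - 2 * pi * y))))"
      by (subst Bochner_Integration.integral_sum) (auto intro!: W)
    also have "\<dots> = 0"
      by (rule integral_eq_zero_AE) (use rel in eventually_elim, simp flip: mult.assoc sum_distrib_right)
    finally show "(LINT \<gamma>|lborel. indicator {- real n..real n} \<gamma> * S \<gamma> * cis (\<xi> * \<gamma>)) = 0"
      by (simp add: a_def b_def)
  qed
  then have "AE \<gamma> in lborel. \<forall>n. indicator {- real n..real n} \<gamma> * S \<gamma> = 0"
    unfolding AE_all_countable by blast
  then show ?thesis
  proof eventually_elim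
    case (elim \<gamma>)
    obtain n :: nat where "\<bar>\<gamma>\<bar> \<le> real n" using real_arch_simple by blast
    then have "indicator {- real n..real n} \<gamma> = (1::complex)" by (auto simp: indicator_def)
    with elim[rule_format, of n] show ?case by (simp add: S_def)
  qed
qed

section \<open>Linear independence\<close>

text \<open>A nonzero value would persist on a nonempty open set, which is not a null set.\<close>

lemma continuous_AE_zero_imp_zero:
  fixes E :: "real \<Rightarrow> 'a::real_normed_vector"
  assumes cont: "continuous_on {A<..} E" and ae: "AE x in lborel. x > A \<longrightarrow> E x = 0" and "x > A"
  shows "E x = 0"
proof (rule ccontr)
  assume "E x \<noteq> 0"
  define U where "U = {A<..} \<inter> E -` (- {0})"
  have "open U" unfolding U_def by (intro continuous_open_preimage[OF cont]) auto
  moreover have "x \<in> U" using \<open>x > A\<close> \<open>E x \<noteq> 0\<close> by (simp add: U_def)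
  ultimately have "\<not> negligible U" using open_not_negligible by blast
  moreover have "negligible U"
  proof -
    have "AE x in lebesgue. x \<notin> U"
      using ae unfolding AE_completion_iff by eventually_elim (auto simp: U_def)
    moreover have "U \<in> sets lebesgue" using \<open>open U\<close> by (simp add: borel_open)
    ultimately show ?thesis by (simp add: negligible_iff_null_sets AE_iff_null_sets)
  qed
  ultimately show False by blast
qed

lemma (in hardy_field) complexified_eventually_continuous:
  assumes "G \<in> complexified"
  shows "\<forall>\<^sub>F x in at_top. isCont G x"
proof -
  obtain G' where "\<forall>\<^sub>F x in at_top. (G has_vector_derivative G' x) (at x)"
    using complexified_deriv[OF assms] by blast
  then show ?thesis by eventually_elim (rule has_vector_derivative_continuous)
qed

text \<open>Elements of a Hardy field are eventually differentiable, hence continuous, so a relation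
  that holds almost everywhere near infinity holds at every large point.\<close>

lemma (in hardy_field) exponentials_AE_independent:
  assumes "finite B" and G: "\<And>b. b \<in> B \<Longrightarrow> G b \<in> complexified"
    and ae: "AE x in lborel. x > A \<longrightarrow> (\<Sum>b\<in>B. cis (b * x) * G b x) = 0" and "b \<in> B"
  shows "\<forall>\<^sub>F x in at_top. G b x = 0"
proof -
  have "\<forall>\<^sub>F x in at_top. \<forall>b\<in>B. isCont (G b) x"
    using G complexified_eventually_continuous assms(1) by (intro eventually_ball_finite) auto
  then obtain A' where A': "\<And>x b. x \<ge> A' \<Longrightarrow> b \<in> B \<Longrightarrow> isCont (G b) x"
    by (auto simp: eventually_at_top_linorder)
  have "(\<Sum>b\<in>B. cis (b * x) * G b x) = 0" if "x > max A A'" for x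
  proof (rule continuous_AE_zero_imp_zero[OF _ _ that])
    have "continuous_on {max A A'<..} (G b)" if "b \<in> B" for b
      using A' that by (intro continuous_at_imp_continuous_on) auto
    then show "continuous_on {max A A'<..} (\<lambda>x. \<Sum>b\<in>B. cis (b * x) * G b x)"
      unfolding cis_conv_exp by (intro continuous_intros) auto
    show "AE x in lborel. x > max A A' \<longrightarrow> (\<Sum>b\<in>B. cis (b * x) * G b x) = 0"
      using ae by eventually_elim auto
  qed
  then have "\<forall>\<^sub>F x in at_top. (\<Sum>b\<in>B. cis (b * x) * G b x) = 0"
    unfolding eventually_at_top_dense by blast
  from exponentials_independent[OF assms(1) G this] \<open>b \<in> B\<close> show ?thesis by blast
qed

text \<open>The finitely many dilates of the \<open>f j\<close> lie in one common Hardy field, whose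
  complexification then contains every combination of the dilates of \<open>F\<close> by elements of
  \<open>L\<close>.\<close>

lemma LE_exponentials_independent:
  fixes f :: "nat \<Rightarrow> real \<Rightarrow> real" and a :: "nat \<Rightarrow> complex"
  assumes f: "\<And>j. j < m \<Longrightarrow> f j \<in> LE"
    and B: "finite B" and L: "finite L" "L \<subseteq> {0<..}"
    and F: "\<And>x. F x = (\<Sum>j<m. a j * of_real (f j x))"
    and ae: "AE x in lborel. x > A \<longrightarrow> (\<Sum>b\<in>B. cis (b * x) * dilation_comb L (C b) F x) = 0"
    and b: "b \<in> B"
  shows "\<forall>\<^sub>F x in at_top. dilation_comb L (C b) F x = 0"
proof -
  define S where "S = (\<lambda>(j, u) x. f j (inverse u * x)) ` ({..<m} \<times> L)"
  have "S \<subseteq> LE" using f L(2) by (auto simp: S_def intro!: LE_dilate)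
  then obtain K where K: "hardy_field K" "S \<subseteq> K"
    using finite_LE_in_hardy_field[of S] L(1) by (auto simp: S_def)
  interpret hardy_field K by (rule K(1))
  have "dilation_comb L (C b) F \<in> complexified" for b
  proof -
    have "dilation_comb L (C b) F = (\<lambda>x. \<Sum>u\<in>L. C b u * (\<Sum>j<m. a j * of_real (f j (inverse u * x))))"
      by (simp add: dilation_comb_def F fun_eq_iff divide_inverse mult.commute)
    also have "\<dots> \<in> complexified"
    proof (intro complexified_sum complexified_mult complexified_const complexified_of_real)
      fix u j assume "u \<in> L" "j \<in> {..<m}"
      then have "(\<lambda>x. f j (inverse u * x)) \<in> S"
        unfolding S_def by (intro image_eqI[of _ _ "(j, u)"]) auto
      then show "(\<lambda>x. f j (inverse u * x)) \<in> K" using K(2) by blast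
    qed
    finally show ?thesis .
  qed
  then show ?thesis by (rule exponentials_AE_independent[OF B _ ae b])
qed

lemma square_integrable_representative:
  fixes f :: "real \<Rightarrow> complex"
  assumes "square_integrable f"
  obtains f' where "f' \<in> borel_measurable borel" "AE x in lborel. f x = f' x"
    "integrable lborel (\<lambda>x. (cmod (f' x))\<^sup>2)"
proof -
  have f: "f \<in> borel_measurable lebesgue" "integrable lebesgue (\<lambda>x. (cmod (f x))\<^sup>2)"
    using assms by (auto simp: square_integrable_def)
  obtain f' where [measurable]: "f' \<in> borel_measurable borel" and f': "AE x in lborel. f x = f' x"
    using borel_representative[OF f(1)] by blast
  have "(\<lambda>x. (cmod (f' x))\<^sup>2) \<in> borel_measurable borel" by measurable
  moreover have "AE x in lborel. (cmod (f x))\<^sup>2 = (cmod (f' x))\<^sup>2"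
    using f' by eventually_elim simp
  ultimately have "integrable lborel (\<lambda>x. (cmod (f' x))\<^sup>2)"
    using lebesgue_integral_representative(2)[OF borel_measurable_integrable[OF f(2)]] f(2) by blast
  then show thesis by (intro that[of f'] f') auto
qed

theorem theorem4p2:
  fixes \<phi> \<phi>hat :: "real \<Rightarrow> complex"
    and m :: nat and a :: "nat \<Rightarrow> complex" and g :: "nat \<Rightarrow> real \<Rightarrow> real"
    and N :: nat and p :: "nat \<Rightarrow> real \<times> real"
  assumes "square_integrable \<phi>"
    and "\<not> (AE x in lebesgue. \<phi> x = 0)"
    and "is_L2_fourier \<phi> \<phi>hat"
    and "\<And>j. j < m \<Longrightarrow> square_integrable (g j)"
    and "\<And>j. j < m \<Longrightarrow> germ (g j) \<in> LE_germs"
    and "AE \<gamma> in lebesgue. \<phi>hat \<gamma> = (\<Sum>j<m. a j * complex_of_real (g j \<gamma>))"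
    and "\<not> (AE \<gamma> in lebesgue. \<gamma> > 0 \<longrightarrow> \<phi>hat \<gamma> = 0)"
    and "p ` {1..N} \<subseteq> {0<..} \<times> UNIV"
    and "inj_on p {1..N}"
  shows "ae_linearly_independent N (wavelet_system \<phi> p)"
  unfolding ae_linearly_independent_def
proof (intro allI impI ballI)
  fix c :: "nat \<Rightarrow> complex" and k0
  assume dep: "AE x in lebesgue. (\<Sum>k=1..N. c k * wavelet_system \<phi> p k x) = 0" and k0: "k0 \<in> {1..N}"
  \<comment> \<open>\<open>\<omega> k\<close> is the frequency contributed by the translation: the
    transform of the \<open>k\<close>-th function is
    \<open>1 / l k * cis (\<omega> k * \<gamma>)\<close> times the transform of \<phi> at
    \<open>\<gamma> / l k\<close>.\<close>
  define l \<beta> \<omega> where "l k = fst (p k)" and "\<beta> k = snd (p k)" and "\<omega> k = - 2 * pi * \<beta> k / l k" for k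
  have lpos: "l k > 0" if "k \<in> {1..N}" for k using assms(8) that by (force simp: l_def)
  obtain \<phi>' where \<phi>': "\<phi>' \<in> borel_measurable borel" "AE x in lborel. \<phi> x = \<phi>' x"
      "integrable lborel (\<lambda>x. (cmod (\<phi>' x))\<^sup>2)"
    using square_integrable_representative[OF assms(1)] by blast
  have "square_integrable \<phi>hat" using assms(3) by (auto simp: is_L2_fourier_def L2_tendsto_def)
  then obtain \<psi> where \<psi>: "\<psi> \<in> borel_measurable borel" "AE x in lborel. \<phi>hat x = \<psi> x"
      "integrable lborel (\<lambda>x. (cmod (\<psi> x))\<^sup>2)"
    using square_integrable_representative by blast
  have "AE x in lborel. \<forall>k\<in>{1..N}. \<phi> (l k * x - \<beta> k) = \<phi>' (l k * x - \<beta> k)"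
  proof (intro AE_finite_allI)
    fix k assume "k \<in> {1..N}"
    then have "l k \<noteq> 0" using lpos by fastforce
    from AE_lborel_affine[OF \<phi>'(2) this, of "- \<beta> k"]
    show "AE x in lborel. \<phi> (l k * x - \<beta> k) = \<phi>' (l k * x - \<beta> k)" by simp
  qed simp
  with dep[unfolded AE_completion_iff]
  have "AE x in lborel. (\<Sum>k\<in>{1..N}. c k * \<phi>' (l k * x - \<beta> k)) = 0"
    by eventually_elim (simp add: wavelet_system_def l_def \<beta>_def)
  from L2_fourier_affine_relation[OF assms(3) \<phi>'(1,2) \<psi>(1,2) \<phi>'(3) \<psi>(3) _ lpos this]
  have rel: "AE \<gamma> in lborel. (\<Sum>k\<in>{1..N}. c k / of_real (l k) * cis (\<omega> k * \<gamma>) * \<psi> (\<gamma> / l k)) = 0"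
    by (simp add: \<omega>_def)
  define B L where "B = \<omega> ` {1..N}" and "L = l ` {1..N}"
  have BL: "finite B" "finite L" "L \<subseteq> {0<..}" using lpos by (auto simp: B_def L_def)
  \<comment> \<open>Different \<open>k\<close> may share a frequency; their terms are collected into
    one operator. As the pair \<open>(\<omega> k, l k)\<close> determines \<open>p k\<close>, no two
    \<open>k\<close> fall into the same sum.\<close>
  define C where "C b u = (\<Sum>k\<in>{k\<in>{1..N}. (\<omega> k, l k) = (b, u)}. c k / of_real (l k))" for b u
  have group: "(\<Sum>b\<in>B. cis (b * x) * dilation_comb L (C b) \<psi> x)
      = (\<Sum>k\<in>{1..N}. c k / of_real (l k) * cis (\<omega> k * x) * \<psi> (x / l k))" for x
  proof -
    have "(\<Sum>b\<in>B. cis (b * x) * dilation_comb L (C b) \<psi> x)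
        = (\<Sum>(b, u)\<in>B \<times> L. \<Sum>k\<in>{k\<in>{1..N}. (\<omega> k, l k) = (b, u)}. c k / of_real (l k) * cis (b * x) * \<psi> (x / u))"
      unfolding dilation_comb_def C_def sum_distrib_left sum_distrib_right sum.cartesian_product
      by (simp add: mult_ac)
    also have "\<dots> = (\<Sum>y\<in>B \<times> L. \<Sum>k\<in>{k\<in>{1..N}. (\<omega> k, l k) = y}.
        c k / of_real (l k) * cis (\<omega> k * x) * \<psi> (x / l k))"
      by (intro sum.cong refl) auto
    also have "\<dots> = (\<Sum>k\<in>{1..N}. c k / of_real (l k) * cis (\<omega> k * x) * \<psi> (x / l k))"
      by (intro sum.group) (auto simp: B_def L_def)
    finally show ?thesis .
  qed
  have "\<forall>j\<in>{..<m}. \<exists>f. f \<in> LE \<and> (\<forall>\<^sub>F x in at_top. g j x = f x)"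
  proof
    fix j assume "j \<in> {..<m}"
    then obtain f where "f \<in> LE" "germ (g j) = germ f" using assms(5) by (auto simp: LE_germs_def)
    moreover have "g j \<in> germ (g j)" by (simp add: germ_def)
    ultimately show "\<exists>f. f \<in> LE \<and> (\<forall>\<^sub>F x in at_top. g j x = f x)" by (auto simp: germ_def)
  qed
  then obtain f where f: "\<And>j. j < m \<Longrightarrow> f j \<in> LE" "\<And>j. j < m \<Longrightarrow> \<forall>\<^sub>F x in at_top. g j x = f j x"
    by (metis lessThan_iff)
  \<comment> \<open>\<open>F\<close> need agree with \<psi> only near infinity and up to null sets,
    but it is a combination of functions in \<open>LE\<close>, so the Hardy field argument is run on
    \<open>F\<close>.\<close>
  define F where "F x = (\<Sum>j<m. a j * complex_of_real (f j x))" for x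
  have "\<forall>\<^sub>F x in at_top. \<forall>j\<in>{..<m}. g j x = f j x"
    using f(2) by (intro eventually_ball_finite) auto
  then obtain A where A: "\<And>x j. x \<ge> A \<Longrightarrow> j < m \<Longrightarrow> g j x = f j x"
    by (auto simp: eventually_at_top_linorder)
  have \<psi>F: "AE x in lborel. x > A \<longrightarrow> \<psi> x = F x"
    using \<psi>(2) assms(6)[unfolded AE_completion_iff] by eventually_elim (auto simp: F_def A)
  \<comment> \<open>Beyond \<open>A'\<close> every dilated argument \<open>x / u\<close> exceeds
    \<open>A\<close>, so all dilates of \<psi> can be replaced by those of \<open>F\<close>.\<close>
  obtain A' where A': "\<And>u. u \<in> L \<Longrightarrow> A' \<ge> A * u"
  proof
    fix u assume "u \<in> L"
    then show "A * u \<le> Max ((\<lambda>u. A * u) ` L)" using BL(2) by (intro Max_ge) auto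
  qed
  have "AE x in lborel. \<forall>u\<in>L. x / u > A \<longrightarrow> \<psi> (x / u) = F (x / u)"
    using BL by (intro AE_finite_allI AE_lborel_dilate(2)[OF \<psi>F]) auto
  then have tail: "AE x in lborel. x > A' \<longrightarrow> (\<forall>b. dilation_comb L (C b) \<psi> x = dilation_comb L (C b) F x)"
  proof eventually_elim
    case (elim x)
    have "x / u > A" if "x > A'" "u \<in> L" for u
      using A'[OF that(2)] that BL(3) by (auto simp: less_divide_eq)
    then show ?case using elim by (auto simp: dilation_comb_def intro!: sum.cong)
  qed
  have zero: "AE x in lborel. x > 0 \<longrightarrow> dilation_comb L (C b) \<psi> x = 0" if b: "b \<in> B" for b
  proof -
    have "\<exists>A''. \<forall>b\<in>B. AE x in lborel. x > A'' \<longrightarrow> dilation_comb L (C b) \<psi> x = 0"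
    proof -
      have "AE x in lborel. x > A' \<longrightarrow> (\<Sum>b\<in>B. cis (b * x) * dilation_comb L (C b) F x) = 0"
        using rel tail unfolding group[symmetric] by eventually_elim auto
      then have "\<forall>\<^sub>F x in at_top. \<forall>b\<in>B. dilation_comb L (C b) F x = 0"
        using BL(1) by (intro eventually_ball_finite ballI LE_exponentials_independent[OF f(1) BL F_def]) auto
      then obtain A2 where "\<And>x b. x \<ge> A2 \<Longrightarrow> b \<in> B \<Longrightarrow> dilation_comb L (C b) F x = 0"
        by (auto simp: eventually_at_top_linorder)
      with tail have "AE x in lborel. x > max A' A2 \<longrightarrow> dilation_comb L (C b) \<psi> x = 0" if "b \<in> B" for b
        by (auto elim!: eventually_mono simp: that)
      then show ?thesis by blast
    qed
    then obtain A'' where "\<And>b. b \<in> B \<Longrightarrow> AE x in lborel. x > A'' \<longrightarrow> dilation_comb L (C b) \<psi> x = 0"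
      by blast
    note tail_zero = this
    have "AE x in lborel. x > 0 \<longrightarrow> (\<Sum>b\<in>B. cis (b * x) * dilation_comb L (C b) \<psi> x) = 0"
      using rel unfolding group[symmetric] by eventually_elim simp
    from dilation_comb_eventually_zero_imp_zero[OF BL this tail_zero b] show ?thesis .
  qed
  show "c k0 = 0"
  proof (rule ccontr)
    assume "c k0 \<noteq> 0"
    have "{k\<in>{1..N}. (\<omega> k, l k) = (\<omega> k0, l k0)} = {k0}"
    proof -
      have "k = k0" if "k \<in> {1..N}" "\<omega> k = \<omega> k0" "l k = l k0" for k
      proof -
        have "\<beta> k = \<beta> k0" using that lpos[OF k0] by (simp add: \<omega>_def)
        then have "p k = p k0" using that by (simp add: prod_eq_iff l_def \<beta>_def)
        then show ?thesis using assms(9) that k0 by (auto dest: inj_onD)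
      qed
      then show ?thesis using k0 by auto
    qed
    then have "C (\<omega> k0) (l k0) \<noteq> 0" using \<open>c k0 \<noteq> 0\<close> lpos[OF k0] by (simp add: C_def)
    moreover have "\<omega> k0 \<in> B" "l k0 \<in> L" using k0 by (auto simp: B_def L_def)
    \<comment> \<open>The operator of \<open>\<omega> k0\<close> has a nonzero coefficient, hence is
      injective on the positive half line, yet it kills \<psi>.\<close>
    ultimately have "AE x in lborel. x > 0 \<longrightarrow> \<psi> x = 0"
      using zero by (intro dilation_comb_zero_imp_zero[OF \<psi>(1,3) BL(2,3)]) auto
    then have "AE \<gamma> in lebesgue. \<gamma> > 0 \<longrightarrow> \<phi>hat \<gamma> = 0"
      using \<psi>(2) unfolding AE_completion_iff by eventually_elim auto
    then show False using assms(7) by blast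
  qed
qed

end
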